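(* Let $I$ be a closed ideal of the Fréchet lattice $(E,\tau)$. If $I$ has the sequential weak Dunford-Pettis property and $E/I$ has the $(\dot w_\tau,\dot\tau)$-PSP, then $E$ has the sequential weak Dunford-Pettis property.
   Context: A Fréchet lattice is a Riesz space endowed with a locally convex-solid (hence linear), metrizable and complete topology; a locally convex topology on a Riesz space is locally convex-solid if it is generated by a family of Riesz seminorms. A Fréchet lattice $E$ has the sequential weak Dunford-Pettis property if $\varphi_n(x_n)\to 0$ whenever $(x_n)_n$ is a weakly null sequence in $E$ formed by positive vectors and $(\varphi_n)_n$ is a weakly null sequence in the strong dual $E^*_\beta$ of $E$ (the topological dual of $E$ with the topology of uniform convergence on bounded subsets of $E$). Given linear topologies $\tau_1,\tau_2$ on a Riesz space $F$, $F$ has the $(\tau_1,\tau_2)$-positive Schur property, $(\tau_1,\tau_2)$-PSP, if $\tau_1$-null sequences in $F$ formed by positive elements are $\tau_2$-null. $w_\tau$ denotes the weak topology on $E$ with respect to $\tau$. The ideal $I$ carries the relative topology of $\tau$. $E/I$ is the quotient Riesz space, ordered by $\dot x\le\dot y$ if there are $x_1\in\dot x$, $y_1\in\dot y$ with $x_1\le y_1$. $\dot\tau$ and $\dot w_\tau$ denote the quotient topologies on $E/I$ associated to $\tau$ and $w_\tau$ respectively (the finest topology making the quotient map $E\to E/I$ continuous when $E$ carries $\tau$, respectively $w_\tau$); $\dot w_\tau$ coincides with the weak topology of $(E/I,\dot\tau)$. *)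

theory Defs
  imports "HOL-Analysis.Analysis" "HOL-Library.Function_Algebras" "HOL-Library.Lattice_Algebras"
begin

class riesz_space = ordered_real_vector + lattice_ab_group_add_abs

text \<open>
  Pointwise scalar multiplication, complementing the pointwise addition of
  \<^theory>\<open>HOL-Library.Function_Algebras\<close>.
\<close>

instantiation "fun" :: (type, real_vector) real_vector
begin

definition scaleR_fun :: "real \<Rightarrow> ('a \<Rightarrow> 'b) \<Rightarrow> 'a \<Rightarrow> 'b" where
  "scaleR_fun c f = (\<lambda>x. c *\<^sub>R f x)"

instance
  by standard (simp_all add: scaleR_fun_def fun_eq_iff scaleR_add_right scaleR_add_left)

end

section \<open>Topological vector spaces\<close>

text \<open>
  A topological vector space is given by a topology \<open>T\<close> on a linear subspace
  \<open>topspace T\<close> of the ambient type. Thus a subspace with the relative topology and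
  a dual space, whose ambient type is a function type, fall under the same notions.
\<close>

definition linear_functional_on :: "'a::real_vector set \<Rightarrow> ('a \<Rightarrow> real) \<Rightarrow> bool" where
  "linear_functional_on V f \<longleftrightarrow>
     (\<forall>x\<in>V. \<forall>y\<in>V. f (x + y) = f x + f y) \<and> (\<forall>c. \<forall>x\<in>V. f (c *\<^sub>R x) = c * f x)"

text \<open>
  A functional on \<open>topspace T\<close> is represented by its extension by \<open>0\<close>, which makes the
  representation unique and compatible with the pointwise vector space operations.
\<close>

definition topological_dual :: "'a::real_vector topology \<Rightarrow> ('a \<Rightarrow> real) set" where
  "topological_dual T =
     {f. linear_functional_on (topspace T) f \<and> continuous_map T euclideanreal f \<and>
         (\<forall>x. x \<notin> topspace T \<longrightarrow> f x = 0)}"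

definition weak_topology :: "'a::real_vector topology \<Rightarrow> 'a topology" where
  "weak_topology T =
     topology_generated_by {{x \<in> topspace T. f x \<in> U} | f U. f \<in> topological_dual T \<and> open U}"

lemma zero_in_topological_dual: "0 \<in> topological_dual T"
  by (simp add: topological_dual_def linear_functional_on_def zero_fun_def)

lemma topspace_weak_topology:
  fixes T :: "'a::real_vector topology"
  shows "topspace (weak_topology T) = topspace T"
proof -
  have "topspace T \<in> {{x \<in> topspace T. f x \<in> U} | f U. f \<in> topological_dual T \<and> open U}"
    using zero_in_topological_dual[of T]
    by (intro CollectI exI[of _ "0 :: 'a \<Rightarrow> real"] exI[of _ UNIV]) simp
  then show ?thesis
    unfolding weak_topology_def topology_generated_by_topspace by auto
qed

definition seminorm_topology :: "'a::real_vector set \<Rightarrow> ('a \<Rightarrow> real) set \<Rightarrow> 'a topology" where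
  "seminorm_topology V P =
     topology_generated_by (insert V {{y \<in> V. p (y - x) < e} | p x e. p \<in> P \<and> x \<in> V \<and> 0 < e})"

lemma topspace_seminorm_topology: "topspace (seminorm_topology V P) = V"
  unfolding seminorm_topology_def topology_generated_by_topspace by auto

definition tvs_bounded :: "'a::real_vector topology \<Rightarrow> 'a set \<Rightarrow> bool" where
  "tvs_bounded T B \<longleftrightarrow> B \<subseteq> topspace T \<and>
     (\<forall>U. openin T U \<and> 0 \<in> U \<longrightarrow> (\<exists>r>0. \<forall>t\<ge>r. B \<subseteq> (\<lambda>x. t *\<^sub>R x) ` U))"

text \<open>
  Uniform convergence on bounded sets; \<open>B = {}\<close> is left out because the supremum of the
  empty set of reals is unspecified.
\<close>

definition strong_dual :: "'a::real_vector topology \<Rightarrow> ('a \<Rightarrow> real) topology" where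
  "strong_dual T =
     seminorm_topology (topological_dual T)
       {\<lambda>f. SUP x\<in>B. \<bar>f x\<bar> | B. tvs_bounded T B \<and> B \<noteq> {}}"

lemma topspace_strong_dual: "topspace (strong_dual T) = topological_dual T"
  by (simp add: strong_dual_def topspace_seminorm_topology)

definition tvs_cauchy_filter :: "'a::real_vector topology \<Rightarrow> 'a filter \<Rightarrow> bool" where
  "tvs_cauchy_filter T F \<longleftrightarrow> F \<noteq> bot \<and> F \<le> principal (topspace T) \<and>
     (\<forall>U. openin T U \<and> 0 \<in> U \<longrightarrow> (\<forall>\<^sub>F (x, y) in F \<times>\<^sub>F F. x - y \<in> U))"

definition tvs_complete :: "'a::real_vector topology \<Rightarrow> bool" where
  "tvs_complete T \<longleftrightarrow> (\<forall>F. tvs_cauchy_filter T F \<longrightarrow> (\<exists>l. limitin T (\<lambda>x. x) l F))"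

section \<open>Frechet lattices\<close>

definition riesz_seminorm :: "('a::riesz_space \<Rightarrow> real) \<Rightarrow> bool" where
  "riesz_seminorm p \<longleftrightarrow>
     (\<forall>x y. p (x + y) \<le> p x + p y) \<and> (\<forall>c x. p (c *\<^sub>R x) = \<bar>c\<bar> * p x) \<and>
     (\<forall>x y. \<bar>x\<bar> \<le> \<bar>y\<bar> \<longrightarrow> p x \<le> p y)"

definition locally_convex_solid :: "'a::riesz_space topology \<Rightarrow> bool" where
  "locally_convex_solid \<tau> \<longleftrightarrow>
     (\<exists>P. (\<forall>p\<in>P. riesz_seminorm p) \<and> \<tau> = seminorm_topology UNIV P)"

definition frechet_lattice :: "'a::riesz_space topology \<Rightarrow> bool" where
  "frechet_lattice \<tau> \<longleftrightarrow>
     locally_convex_solid \<tau> \<and> metrizable_space \<tau> \<and> tvs_complete \<tau>"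

definition riesz_ideal :: "'a::riesz_space set \<Rightarrow> bool" where
  "riesz_ideal I \<longleftrightarrow> subspace I \<and> (\<forall>x y. y \<in> I \<and> \<bar>x\<bar> \<le> \<bar>y\<bar> \<longrightarrow> x \<in> I)"

definition seq_weak_dunford_pettis :: "'a::riesz_space topology \<Rightarrow> bool" where
  "seq_weak_dunford_pettis T \<longleftrightarrow>
     (\<forall>x \<phi>. (\<forall>n::nat. x n \<in> topspace T \<and> 0 \<le> x n) \<and>
            limitin (weak_topology T) x 0 sequentially \<and>
            (\<forall>n. \<phi> n \<in> topological_dual T) \<and>
            limitin (weak_topology (strong_dual T)) \<phi> 0 sequentially \<longrightarrow>
            (\<lambda>n. \<phi> n (x n)) \<longlonglongrightarrow> 0)"

text \<open>
  The set \<open>F\<close>, the order \<open>le\<close> and the zero \<open>z\<close> are parameters, since the elements of a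
  quotient are sets, whose type-class order is inclusion.
\<close>

definition positive_schur ::
  "'b set \<Rightarrow> ('b \<Rightarrow> 'b \<Rightarrow> bool) \<Rightarrow> 'b \<Rightarrow> 'b topology \<Rightarrow> 'b topology \<Rightarrow> bool" where
  "positive_schur F le z \<tau>\<^sub>1 \<tau>\<^sub>2 \<longleftrightarrow>
     (\<forall>x. (\<forall>n::nat. x n \<in> F \<and> le z (x n)) \<and> limitin \<tau>\<^sub>1 x z sequentially \<longrightarrow>
          limitin \<tau>\<^sub>2 x z sequentially)"

section \<open>Quotients\<close>

definition coset :: "'a::real_vector set \<Rightarrow> 'a \<Rightarrow> 'a set" where
  "coset I x = {y. y - x \<in> I}"

definition coset_le :: "'a::riesz_space set \<Rightarrow> 'a set \<Rightarrow> bool" where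
  "coset_le X Y \<longleftrightarrow> (\<exists>x\<in>X. \<exists>y\<in>Y. x \<le> y)"

definition quotient_topology :: "'a topology \<Rightarrow> ('a \<Rightarrow> 'b) \<Rightarrow> 'b topology" where
  "quotient_topology T q =
     topology (\<lambda>U. U \<subseteq> q ` topspace T \<and> openin T {x \<in> topspace T. q x \<in> U})"

lemma openin_quotient_topology:
  "openin (quotient_topology T q) U \<longleftrightarrow>
     U \<subseteq> q ` topspace T \<and> openin T {x \<in> topspace T. q x \<in> U}"
proof -
  have "istopology (\<lambda>U. U \<subseteq> q ` topspace T \<and> openin T {x \<in> topspace T. q x \<in> U})"
    unfolding istopology_def
  proof (rule conjI; intro allI impI)
    fix S U
    assume *: "S \<subseteq> q ` topspace T \<and> openin T {x \<in> topspace T. q x \<in> S}"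
      "U \<subseteq> q ` topspace T \<and> openin T {x \<in> topspace T. q x \<in> U}"
    have "{x \<in> topspace T. q x \<in> S \<inter> U} =
        {x \<in> topspace T. q x \<in> S} \<inter> {x \<in> topspace T. q x \<in> U}"
      by blast
    then have "openin T {x \<in> topspace T. q x \<in> S \<inter> U}"
      using * by (simp only: openin_Int)
    with * show "S \<inter> U \<subseteq> q ` topspace T \<and> openin T {x \<in> topspace T. q x \<in> S \<inter> U}"
      by blast
  next
    fix K
    assume *: "\<forall>S\<in>K. S \<subseteq> q ` topspace T \<and> openin T {x \<in> topspace T. q x \<in> S}"
    have "{x \<in> topspace T. q x \<in> \<Union> K} = (\<Union>S\<in>K. {x \<in> topspace T. q x \<in> S})"
      by blast
    moreover have "openin T (\<Union>S\<in>K. {x \<in> topspace T. q x \<in> S})"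
      using * by (intro openin_Union) blast
    ultimately have "openin T {x \<in> topspace T. q x \<in> \<Union> K}"
      by (simp only:)
    with * show "\<Union> K \<subseteq> q ` topspace T \<and> openin T {x \<in> topspace T. q x \<in> \<Union> K}"
      by blast
  qed
  then show ?thesis
    by (simp add: quotient_topology_def topology_inverse')
qed

lemma topspace_quotient_topology: "topspace (quotient_topology T q) = q ` topspace T"
proof (rule subset_antisym)
  show "topspace (quotient_topology T q) \<subseteq> q ` topspace T"
    by (meson openin_quotient_topology openin_topspace)
  have "{x \<in> topspace T. q x \<in> q ` topspace T} = topspace T"
    by auto
  then have "openin (quotient_topology T q) (q ` topspace T)"
    by (simp add: openin_quotient_topology)
  then show "q ` topspace T \<subseteq> topspace (quotient_topology T q)"
    by (rule openin_subset)
qed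

lemma quotient_map_quotient_topology: "quotient_map T (quotient_topology T q) q"
  by (auto simp: quotient_map_def topspace_quotient_topology openin_quotient_topology)

end

theory Submission
  imports Defs
begin

text \<open>
  For a positive weakly null sequence \<open>x\<close>, the positive Schur property of \<open>E/I\<close> yields a null
  sequence \<open>u\<close> with \<open>x n - u n \<in> I\<close>. Then \<open>v n = inf (x n) \<bar>x n - u n\<bar>\<close> is a positive element of \<open>I\<close>
  with \<open>\<bar>x n - v n\<bar> \<le> \<bar>u n\<bar>\<close>, and \<open>\<phi> n (x n) = \<phi> n (v n) + \<phi> n (x n - v n)\<close>. The first summand tends
  to \<open>0\<close> by the hypothesis on \<open>I\<close>. The second does because a weakly null sequence in the strong
  dual, paired with a null sequence of vectors, gives a null sequence of numbers.
\<close>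

section \<open>Seminorm topologies and weak topologies\<close>

text \<open>The difference \<open>x n - u n\<close> lies in the ideal but need not be positive, so
  the hypothesis on \<open>I\<close> does not apply to it. The infimum with \<open>x n\<close>
  restores positivity, and the bound \<open>v n \<le> x n\<close> is what lets weak nullness descend
  from \<open>x\<close> to \<open>v\<close>. It has to descend to the weak topology of
  \<open>I\<close>, whose test functionals live on \<open>I\<close> alone: their values at
  \<open>v n\<close> are squeezed between values of functionals on the whole space at
  \<open>x n\<close>. The \<open>\<phi> n\<close>, in turn, have to stay weakly null in the strong
  dual of \<open>I\<close> after restriction, which holds because bounded subsets of
  \<open>I\<close> are bounded in the whole space. Both transfers, and the pairing with a null
  sequence, rest on one dictionary: a linear functional is continuous iff finitely many of the
  generating seminorms bound it.\<close>

lemma limitin_topology_generated_by: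
  assumes "l \<in> \<Union>S" and "\<And>U. U \<in> S \<Longrightarrow> l \<in> U \<Longrightarrow> \<forall>\<^sub>F n in F. x n \<in> U"
  shows "limitin (topology_generated_by S) x l F"
proof -
  have "\<forall>\<^sub>F n in F. x n \<in> U" if "generate_topology_on S U" "l \<in> U" for U
    using that
  proof induction
    case (UN K)
    then obtain k where k: "k \<in> K" "l \<in> k" by blast
    then have "\<forall>\<^sub>F n in F. x n \<in> k" using UN by blast
    then show ?case by (rule eventually_mono) (use k in blast)
  qed (auto simp: assms(2) eventually_conj)
  then show ?thesis
    using assms(1) by (auto simp: limitin_def openin_topology_generated_by_iff)
qed

lemma limitin_weak_topology:
  "limitin (weak_topology T) x l F \<longleftrightarrow>
     l \<in> topspace T \<and> (\<forall>\<^sub>F n in F. x n \<in> topspace T) \<and>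
     (\<forall>f\<in>topological_dual T. ((\<lambda>n. f (x n)) \<longlongrightarrow> f l) F)"
proof (intro iffI conjI ballI)
  assume lim: "limitin (weak_topology T) x l F"
  then show l: "l \<in> topspace T"
    using limitin_topspace topspace_weak_topology by fastforce
  show "\<forall>\<^sub>F n in F. x n \<in> topspace T"
    using lim by (metis l limitin_def openin_topspace topspace_weak_topology)
  fix f assume f: "f \<in> topological_dual T"
  show "((\<lambda>n. f (x n)) \<longlongrightarrow> f l) F"
  proof (rule topological_tendstoI)
    fix U :: "real set" assume U: "open U" "f l \<in> U"
    have "openin (weak_topology T) {x \<in> topspace T. f x \<in> U}"
      unfolding weak_topology_def using f U by (intro topology_generated_by_Basis) blast
    then have "\<forall>\<^sub>F n in F. x n \<in> {x \<in> topspace T. f x \<in> U}"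
      using lim l U unfolding limitin_def by blast
    then show "\<forall>\<^sub>F n in F. f (x n) \<in> U" by (rule eventually_mono) blast
  qed
next
  assume *: "l \<in> topspace T \<and> (\<forall>\<^sub>F n in F. x n \<in> topspace T) \<and>
     (\<forall>f\<in>topological_dual T. ((\<lambda>n. f (x n)) \<longlongrightarrow> f l) F)"
  show "limitin (weak_topology T) x l F"
    unfolding weak_topology_def
  proof (rule limitin_topology_generated_by)
    show "l \<in> \<Union> {{x \<in> topspace T. f x \<in> U} | f U. f \<in> topological_dual T \<and> open U}"
      using * topspace_weak_topology[of T]
      unfolding weak_topology_def topology_generated_by_topspace by simp
  next
    fix W assume "W \<in> {{x \<in> topspace T. f x \<in> U} | f U. f \<in> topological_dual T \<and> open U}" "l \<in> W"
    then obtain f U where fU: "f \<in> topological_dual T" "open U" "f l \<in> U"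
      and W: "W = {x \<in> topspace T. f x \<in> U}" by blast
    then have "\<forall>\<^sub>F n in F. f (x n) \<in> U"
      using * topological_tendstoD by blast
    moreover have "\<forall>\<^sub>F n in F. x n \<in> topspace T" using * by blast
    ultimately show "\<forall>\<^sub>F n in F. x n \<in> W"
      unfolding W by eventually_elim blast
  qed
qed

text \<open>Relative to \<open>V\<close>, because the same facts serve the whole space and a dual,
  which is a subspace of its function type. Nonnegativity follows from the two clauses when
  \<open>V\<close> is a subspace.\<close>

definition seminorm_on :: "'a::real_vector set \<Rightarrow> ('a \<Rightarrow> real) \<Rightarrow> bool" where
  "seminorm_on V p \<longleftrightarrow>
     (\<forall>x\<in>V. \<forall>y\<in>V. p (x + y) \<le> p x + p y) \<and> (\<forall>c. \<forall>x\<in>V. p (c *\<^sub>R x) = \<bar>c\<bar> * p x)"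

lemma seminorm_onD:
  assumes "seminorm_on V p" "x \<in> V"
  shows seminorm_on_triangle: "y \<in> V \<Longrightarrow> p (x + y) \<le> p x + p y"
    and seminorm_on_scale: "p (c *\<^sub>R x) = \<bar>c\<bar> * p x"
    and seminorm_on_zero: "p 0 = 0"
proof -
  show "y \<in> V \<Longrightarrow> p (x + y) \<le> p x + p y" and scale: "p (c *\<^sub>R x) = \<bar>c\<bar> * p x" for c
    using assms unfolding seminorm_on_def by blast+
  show "p 0 = 0" using scale[of 0] by simp
qed

lemma seminorm_on_nonneg:
  assumes "seminorm_on V p" "subspace V" "x \<in> V"
  shows "0 \<le> p x"
proof -
  have "p 0 \<le> p x + p ((-1) *\<^sub>R x)"
    using seminorm_on_triangle[OF assms(1), of x "(-1) *\<^sub>R x"] assms subspace_scale[OF assms(2,3), of "-1"]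
    by simp
  then show ?thesis
    using seminorm_on_zero[OF assms(1,3)] seminorm_on_scale[OF assms(1,3), of "-1"] by simp
qed

lemma openin_seminorm_ball:
  assumes "p \<in> P" "x \<in> V" "0 < e"
  shows "openin (seminorm_topology V P) {y \<in> V. p (y - x) < e}"
  unfolding seminorm_topology_def by (rule topology_generated_by_Basis) (use assms in blast)

text \<open>The subbasis has balls with arbitrary centres, whereas the estimates below need balls
  centred at the given point. Induction on the generation of \<open>U\<close>: an intersection
  unites the finite sets of seminorms, and a ball around \<open>a\<close> is recentred at
  \<open>x\<close> by shrinking its radius by \<open>p (x - a)\<close>.\<close>

lemma seminorm_topology_neighbourhood:
  assumes V: "subspace V" and P: "\<And>p. p \<in> P \<Longrightarrow> seminorm_on V p"
    and U: "openin (seminorm_topology V P) U" and x: "x \<in> U"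
  obtains Q e where "finite Q" "Q \<subseteq> P" "0 < (e::real)" "{y \<in> V. \<forall>q\<in>Q. q (y - x) < e} \<subseteq> U"
proof -
  have "\<exists>Q e. finite Q \<and> Q \<subseteq> P \<and> 0 < e \<and> (\<forall>y\<in>V. (\<forall>q\<in>Q. q (y - x) < e) \<longrightarrow> y \<in> U)"
    using U[unfolded seminorm_topology_def openin_topology_generated_by_iff] x
  proof induction
    case Empty
    then show ?case by simp
  next
    case (Int a b)
    then have "x \<in> a" "x \<in> b" by auto
    obtain Q e where "finite Q" "Q \<subseteq> P" "0 < e" "\<forall>y\<in>V. (\<forall>q\<in>Q. q (y - x) < e) \<longrightarrow> y \<in> a"
      using Int.IH(1)[OF \<open>x \<in> a\<close>] by blast
    moreover obtain R d where "finite R" "R \<subseteq> P" "0 < d" "\<forall>y\<in>V. (\<forall>q\<in>R. q (y - x) < d) \<longrightarrow> y \<in> b"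
      using Int.IH(2)[OF \<open>x \<in> b\<close>] by blast
    ultimately show ?case
      by (intro exI[of _ "Q \<union> R"] exI[of _ "min e d"]) auto
  next
    case (UN K)
    then obtain k where "k \<in> K" "x \<in> k" by blast
    obtain Q e where "finite Q" "Q \<subseteq> P" "0 < e" "\<forall>y\<in>V. (\<forall>q\<in>Q. q (y - x) < e) \<longrightarrow> y \<in> k"
      using UN.IH[OF \<open>k \<in> K\<close> \<open>x \<in> k\<close>] by blast
    with \<open>k \<in> K\<close> show ?case by (intro exI[of _ Q] exI[of _ e]) blast
  next
    case (Basis s)
    then consider "s = V" | p a e where "p \<in> P" "a \<in> V" "0 < e" "s = {y \<in> V. p (y - a) < e}"
      by blast
    then show ?case
    proof cases
      case 1
      then show ?thesis by (intro exI[of _ "{}"] exI[of _ 1]) simp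
    next
      case 2
      have "p (y - a) < e" if "y \<in> V" "p (y - x) < e - p (x - a)" for y
      proof -
        have "p ((y - x) + (x - a)) \<le> p (y - x) + p (x - a)"
          using that 2 Basis V by (intro seminorm_on_triangle[OF P]) (auto intro: subspace_diff)
        with that show ?thesis by simp
      qed
      with 2 Basis show ?thesis
        by (intro exI[of _ "{p}"] exI[of _ "e - p (x - a)"]) auto
    qed
  qed
  then obtain Q e where "finite Q" "Q \<subseteq> P" "0 < e" "\<forall>y\<in>V. (\<forall>q\<in>Q. q (y - x) < e) \<longrightarrow> y \<in> U"
    by blast
  then show ?thesis by (intro that[of Q e]) auto
qed

lemma limitin_seminorm_topology_zero:
  assumes P: "\<And>p. p \<in> P \<Longrightarrow> seminorm_on UNIV p"
  shows "limitin (seminorm_topology UNIV P) x 0 F \<longleftrightarrow> (\<forall>p\<in>P. ((\<lambda>n. p (x n)) \<longlongrightarrow> 0) F)"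
proof (intro iffI ballI)
  fix p assume lim: "limitin (seminorm_topology UNIV P) x 0 F" and p: "p \<in> P"
  show "((\<lambda>n. p (x n)) \<longlongrightarrow> 0) F"
  proof (rule tendstoI)
    fix e :: real assume e: "0 < e"
    have "0 \<in> {y \<in> UNIV. p (y - 0) < e}"
      using e seminorm_on_zero[OF P[OF p] UNIV_I] by simp
    then have "\<forall>\<^sub>F n in F. x n \<in> {y \<in> UNIV. p (y - 0) < e}"
      using lim openin_seminorm_ball[OF p UNIV_I e, of 0] unfolding limitin_def by blast
    then show "\<forall>\<^sub>F n in F. dist (p (x n)) 0 < e"
      by (rule eventually_mono) (use seminorm_on_nonneg[OF P[OF p] subspace_UNIV] in auto)
  qed
next
  assume lim: "\<forall>p\<in>P. ((\<lambda>n. p (x n)) \<longlongrightarrow> 0) F"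
  show "limitin (seminorm_topology UNIV P) x 0 F"
    unfolding seminorm_topology_def
  proof (rule limitin_topology_generated_by)
    fix U assume U: "U \<in> insert UNIV {{y \<in> UNIV. p (y - x) < e} | p x e. p \<in> P \<and> x \<in> UNIV \<and> 0 < e}"
      and 0: "0 \<in> U"
    show "\<forall>\<^sub>F n in F. x n \<in> U"
    proof (cases "U = UNIV")
      case False
      with U obtain p a e where p: "p \<in> P" and U: "U = {y. p (y - a) < e}" by auto
      have "p (0 - a) < e" using 0 U by simp
      \<comment> \<open>A subbasic ball around \<open>a\<close> that contains 0 leaves exactly this
        room for \<open>p (x n)\<close>.\<close>
      then have "\<forall>\<^sub>F n in F. p (x n) < e - p (0 - a)"
        using lim p by (intro order_tendstoD(2)[of _ 0]) auto
      then show ?thesis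
      proof (rule eventually_mono)
        fix n assume "p (x n) < e - p (0 - a)"
        then show "x n \<in> U"
          unfolding U using seminorm_on_triangle[OF P[OF p] UNIV_I UNIV_I, of "x n" "0 - a"] by simp
      qed
    qed simp
  qed simp
qed

lemma tvs_bounded_seminorm_topology:
  assumes P: "\<And>p. p \<in> P \<Longrightarrow> seminorm_on UNIV p"
    and B: "\<And>p. p \<in> P \<Longrightarrow> \<exists>M. \<forall>x\<in>B. p x \<le> M"
  shows "tvs_bounded (seminorm_topology UNIV P) B"
  unfolding tvs_bounded_def topspace_seminorm_topology
proof (intro conjI allI impI subset_UNIV)
  fix U assume U: "openin (seminorm_topology UNIV P) U \<and> 0 \<in> U"
  obtain Q e where Q: "finite Q" "Q \<subseteq> P" "0 < e" "{y \<in> UNIV. \<forall>q\<in>Q. q (y - 0) < e} \<subseteq> U"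
    using seminorm_topology_neighbourhood[OF subspace_UNIV P conjunct1[OF U] conjunct2[OF U]] by blast
  obtain M where M: "\<And>p x. p \<in> P \<Longrightarrow> x \<in> B \<Longrightarrow> p x \<le> M p"
    using B by metis
  \<comment> \<open>The sum majorises all the bounds \<open>M q\<close> at once, so dividing by
    \<open>t \<ge> r\<close> brings every \<open>q x\<close> below \<open>e\<close>. The summand 1
    makes this strict and keeps \<open>r\<close> positive when \<open>Q\<close> is empty.\<close>
  define r where "r = 1 + (\<Sum>q\<in>Q. \<bar>M q\<bar>) / e"
  have "0 < r" unfolding r_def using Q by (simp add: add_pos_nonneg sum_nonneg)
  moreover have "x \<in> (\<lambda>x. t *\<^sub>R x) ` U" if t: "t \<ge> r" and x: "x \<in> B" for t x
  proof -
    have t0: "t > 0" using t \<open>0 < r\<close> by simp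
    have "q (inverse t *\<^sub>R x - 0) < e" if q: "q \<in> Q" for q
    proof -
      have "q x \<le> \<bar>M q\<bar>" using M[of q x] q Q x by fastforce
      also have "\<dots> \<le> (\<Sum>q\<in>Q. \<bar>M q\<bar>)" using q Q by (intro member_le_sum) auto
      also have "\<dots> = (r - 1) * e" using Q by (simp add: r_def)
      also have "\<dots> < t * e" using t Q by simp
      finally have "q x < t * e" .
      moreover have "q (inverse t *\<^sub>R x) = q x / t"
        by (subst seminorm_on_scale[OF P]) (use q Q t0 in \<open>auto simp: field_simps\<close>)
      ultimately show ?thesis using t0 by (simp add: pos_divide_less_eq mult.commute)
    qed
    then have "inverse t *\<^sub>R x \<in> U" using Q by blast
    then show ?thesis using t0 by (intro image_eqI[of _ _ "inverse t *\<^sub>R x"]) auto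
  qed
  ultimately show "\<exists>r>0. \<forall>t\<ge>r. B \<subseteq> (\<lambda>x. t *\<^sub>R x) ` U" by blast
qed

lemma linear_functional_on_diff:
  assumes "linear_functional_on V f" "subspace V" "x \<in> V" "y \<in> V"
  shows "f (x - y) = f x - f y"
proof -
  have "f (x + (-1) *\<^sub>R y) = f x + (-1) * f y"
    using assms subspace_scale[OF assms(2,4), of "-1"] unfolding linear_functional_on_def by metis
  then show ?thesis by simp
qed

text \<open>By homogeneity: the preimage of (-1, 1) contains a ball of finitely many seminorms, and
  dividing \<open>x\<close> by slightly more than \<open>(\<Sum>q\<in>Q. q x) / e\<close> moves it
  into that ball. \<open>W\<close> is kept apart from \<open>V\<close> so that a functional on an
  ideal is estimated by seminorms of the whole space.\<close>

lemma continuous_linear_functional_bound: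
  assumes V: "subspace V" and P: "\<And>p. p \<in> P \<Longrightarrow> seminorm_on V p"
    and f: "linear_functional_on W f" "subspace W" "W \<subseteq> V"
    and cont: "continuous_map (subtopology (seminorm_topology V P) W) euclideanreal f"
  obtains Q e where "finite Q" "Q \<subseteq> P" "0 < (e::real)" "\<And>x. x \<in> W \<Longrightarrow> \<bar>f x\<bar> \<le> (\<Sum>q\<in>Q. q x) / e"
proof -
  have top: "topspace (subtopology (seminorm_topology V P) W) = W"
    using f by (auto simp: topspace_seminorm_topology topspace_subtopology)
  have 0: "0 \<in> W" using f subspace_0 by blast
  have f0: "f 0 = 0" using linear_functional_on_diff[OF f(1,2) 0 0] by simp
  have "openin (subtopology (seminorm_topology V P) W) {x \<in> W. f x \<in> {-1<..<1}}"
    using openin_continuous_map_preimage[OF cont, of "{-1<..<1}"] unfolding top by simp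
  then obtain U where U: "openin (seminorm_topology V P) U" "{x \<in> W. f x \<in> {-1<..<1}} = U \<inter> W"
    unfolding openin_subtopology by blast
  have "0 \<in> {x \<in> W. f x \<in> {-1<..<1}}" using 0 f0 by simp
  then have "0 \<in> U" unfolding U(2) by blast
  obtain Q e where Q: "finite Q" "Q \<subseteq> P" "0 < e" "{y \<in> V. \<forall>q\<in>Q. q (y - 0) < e} \<subseteq> U"
    using seminorm_topology_neighbourhood[OF V P U(1) \<open>0 \<in> U\<close>] by blast
  have "\<bar>f x\<bar> \<le> (\<Sum>q\<in>Q. q x) / e" if x: "x \<in> W" for x
  proof (rule field_le_epsilon)
    fix d :: real assume d: "0 < d"
    have nonneg: "0 \<le> q x" if "q \<in> Q" for q
      using seminorm_on_nonneg[OF P V] that Q x f by blast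
    \<comment> \<open>All seminorms in \<open>Q\<close> may vanish at \<open>x\<close>. The slack
      \<open>d\<close> keeps the divisor \<open>t\<close> positive and is removed by
      \<open>field_le_epsilon\<close>.\<close>
    define t where "t = (\<Sum>q\<in>Q. q x) / e + d"
    have t: "t > 0" unfolding t_def using nonneg Q d by (simp add: add_nonneg_pos sum_nonneg)
    have "q (inverse t *\<^sub>R x) < e" if q: "q \<in> Q" for q
    proof -
      have "q x \<le> (\<Sum>q\<in>Q. q x)" using q Q nonneg by (intro member_le_sum) auto
      also have "\<dots> < t * e" unfolding t_def using Q d by (simp add: field_simps)
      finally have "q x < t * e" .
      moreover have "q (inverse t *\<^sub>R x) = q x / t"
        by (subst seminorm_on_scale[OF P]) (use q Q t x f in \<open>auto simp: field_simps\<close>)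
      ultimately show ?thesis using t by (simp add: pos_divide_less_eq mult.commute)
    qed
    moreover have W: "inverse t *\<^sub>R x \<in> W" using x f subspace_scale by blast
    ultimately have "inverse t *\<^sub>R x \<in> U \<inter> W" using Q(4) f(3) by auto
    then have "\<bar>f (inverse t *\<^sub>R x)\<bar> < 1" unfolding U(2)[symmetric] by auto
    moreover have "f (inverse t *\<^sub>R x) = inverse t * f x"
      using f x unfolding linear_functional_on_def by blast
    ultimately have "\<bar>inverse t * f x\<bar> < 1" by simp
    then have "\<bar>f x\<bar> < t" using t by (simp add: abs_mult field_simps)
    then show "\<bar>f x\<bar> \<le> (\<Sum>q\<in>Q. q x) / e + d" unfolding t_def by simp
  qed
  with Q that show ?thesis by blast
qed

lemma continuous_map_linear_functional:
  assumes V: "subspace V" and P: "\<And>p. p \<in> P \<Longrightarrow> seminorm_on V p"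
    and f: "linear_functional_on V f"
    and Q: "finite Q" "Q \<subseteq> P" and C: "\<And>x. x \<in> V \<Longrightarrow> \<bar>f x\<bar> \<le> C * (\<Sum>q\<in>Q. q x)"
  shows "continuous_map (seminorm_topology V P) euclideanreal f"
  unfolding continuous_map_def topspace_seminorm_topology
proof (intro conjI allI impI)
  fix U :: "real set" assume "openin euclideanreal U"
  then have U: "open U" by simp
  let ?T = "seminorm_topology V P"
  show "openin ?T {x \<in> V. f x \<in> U}"
  proof (subst openin_subopen, intro ballI)
    fix x assume "x \<in> {x \<in> V. f x \<in> U}"
    then have x: "x \<in> V" "f x \<in> U" by auto
    obtain d where d: "0 < d" "\<And>s. \<bar>s - f x\<bar> < d \<Longrightarrow> s \<in> U"
      using U x(2) unfolding open_dist dist_real_def by blast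
    \<comment> \<open>Chosen so that \<open>\<bar>C\<bar> * card Q * (d / D) < d\<close>, also when
      \<open>C\<close> is 0 or \<open>Q\<close> is empty.\<close>
    define D where "D = 1 + \<bar>C\<bar> * card Q"
    have D: "0 < D" unfolding D_def by (simp add: add_pos_nonneg)
    \<comment> \<open>The intersection with \<open>V\<close> keeps \<open>S\<close> inside
      \<open>V\<close> when \<open>Q\<close> is empty.\<close>
    define S where "S = (\<Inter>q\<in>Q. {y \<in> V. q (y - x) < d / D}) \<inter> V"
    have "openin ?T {y \<in> V. q (y - x) < d / D}" if "q \<in> Q" for q
      using Q that x d D by (intro openin_seminorm_ball) auto
    then have "openin ?T S"
      unfolding S_def using openin_INT[OF Q(1), of ?T "\<lambda>q. {y \<in> V. q (y - x) < d / D}"]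
      by (simp only: topspace_seminorm_topology)
    moreover have "x \<in> S"
    proof -
      have "q 0 < d / D" if "q \<in> Q" for q
        using seminorm_on_zero[OF P x(1), of q] that Q(2) d D by auto
      then show ?thesis unfolding S_def using x by auto
    qed
    moreover have "f y \<in> U" if y: "y \<in> S" for y
    proof (rule d(2))
      have yV: "y \<in> V" using y S_def by simp
      then have V': "y - x \<in> V" using x V subspace_diff by blast
      have nonneg: "0 \<le> (\<Sum>q\<in>Q. q (y - x))"
        using seminorm_on_nonneg[OF P V V'] Q by (intro sum_nonneg) blast
      have "\<bar>f y - f x\<bar> = \<bar>f (y - x)\<bar>"
        using linear_functional_on_diff[OF f V yV x(1)] by simp
      also have "\<dots> \<le> C * (\<Sum>q\<in>Q. q (y - x))" by (rule C[OF V'])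
      also have "\<dots> \<le> \<bar>C\<bar> * (\<Sum>q\<in>Q. q (y - x))" using nonneg by (intro mult_right_mono) auto
      also have "\<dots> \<le> \<bar>C\<bar> * (\<Sum>q\<in>Q. d / D)"
        using y unfolding S_def by (intro mult_left_mono sum_mono) (auto intro: less_imp_le)
      also have "\<dots> = (\<bar>C\<bar> * card Q) * d / D" by simp
      also have "\<dots> < d" using D d unfolding D_def by (simp add: field_simps)
      finally show "\<bar>f y - f x\<bar> < d" .
    qed
    ultimately show "\<exists>S. openin ?T S \<and> x \<in> S \<and> S \<subseteq> {x \<in> V. f x \<in> U}"
      unfolding S_def by blast
  qed
qed auto

section \<open>Duals\<close>

lemma topological_dualD:
  assumes "f \<in> topological_dual T"
  shows topological_dual_linear: "linear_functional_on (topspace T) f"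
    and topological_dual_continuous: "continuous_map T euclideanreal f"
  using assms by (auto simp: topological_dual_def)

lemma subspace_topological_dual: "subspace (topological_dual T)"
  unfolding subspace_def
proof (intro conjI ballI allI)
  fix f g assume *: "f \<in> topological_dual T" "g \<in> topological_dual T"
  then show "f + g \<in> topological_dual T"
    unfolding topological_dual_def linear_functional_on_def plus_fun_def
    by (auto simp: algebra_simps intro!: continuous_map_add)
next
  fix c :: real and f assume *: "f \<in> topological_dual T"
  then show "c *\<^sub>R f \<in> topological_dual T"
    unfolding topological_dual_def linear_functional_on_def scaleR_fun_def
    by (auto simp: algebra_simps intro!: continuous_map_real_mult)
qed (rule zero_in_topological_dual)

text \<open>Makes the suprema in \<open>strong_dual\<close> genuine ones: \<open>B\<close> is
  absorbed by the open set where the absolute value of \<open>f\<close> is below 1.\<close>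

lemma topological_dual_bounded:
  assumes "tvs_bounded T B" "0 \<in> topspace T" "f \<in> topological_dual T"
  shows "bdd_above ((\<lambda>x. \<bar>f x\<bar>) ` B)"
proof -
  have lin: "linear_functional_on (topspace T) f" by (rule topological_dual_linear[OF assms(3)])
  have "f (0 *\<^sub>R 0) = 0 * f 0"
    using lin assms(2) unfolding linear_functional_on_def by blast
  then have f0: "f 0 = 0" by simp
  let ?U = "{x \<in> topspace T. f x \<in> {-1<..<1}}"
  have "openin T ?U"
    using openin_continuous_map_preimage[OF topological_dual_continuous[OF assms(3)], of "{-1<..<1}"] by simp
  moreover have "0 \<in> ?U" using assms(2) f0 by simp
  ultimately obtain r where r: "0 < r" "B \<subseteq> (\<lambda>x. r *\<^sub>R x) ` ?U"
    using assms(1) unfolding tvs_bounded_def by (metis order_refl)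
  have "\<bar>f x\<bar> \<le> r" if xB: "x \<in> B" for x
  proof -
    obtain u where u: "x = r *\<^sub>R u" "u \<in> ?U"
      using r(2) xB by blast
    then have "f x = r * f u" using lin unfolding linear_functional_on_def by blast
    moreover have "\<bar>f u\<bar> < 1" using u by auto
    ultimately show ?thesis using r(1) by (simp add: abs_mult)
  qed
  then show ?thesis by (auto intro!: bdd_aboveI)
qed

lemma seminorm_on_SUP_dual:
  assumes "tvs_bounded T B" "B \<noteq> {}" "0 \<in> topspace T"
  shows "seminorm_on (topological_dual T) (\<lambda>f. SUP x\<in>B. \<bar>f x\<bar>)"
  unfolding seminorm_on_def
proof (intro conjI ballI allI)
  note bdd = topological_dual_bounded[OF assms(1,3)]
  fix f g assume fg: "f \<in> topological_dual T" "g \<in> topological_dual T"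
  show "(SUP x\<in>B. \<bar>(f + g) x\<bar>) \<le> (SUP x\<in>B. \<bar>f x\<bar>) + (SUP x\<in>B. \<bar>g x\<bar>)"
  proof (rule cSUP_least[OF assms(2)])
    fix x assume "x \<in> B"
    then show "\<bar>(f + g) x\<bar> \<le> (SUP x\<in>B. \<bar>f x\<bar>) + (SUP x\<in>B. \<bar>g x\<bar>)"
      using cSUP_upper[OF _ bdd[OF fg(1)], of x] cSUP_upper[OF _ bdd[OF fg(2)], of x] by simp
  qed
next
  fix c :: real and f assume f: "f \<in> topological_dual T"
  have le: "(SUP x\<in>B. \<bar>(c *\<^sub>R f) x\<bar>) \<le> \<bar>c\<bar> * (SUP x\<in>B. \<bar>f x\<bar>)" if "f \<in> topological_dual T" for c f
    using cSUP_upper[OF _ topological_dual_bounded[OF assms(1,3) that]]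
    by (intro cSUP_least[OF assms(2)]) (auto simp: scaleR_fun_def abs_mult intro!: mult_left_mono)
  show "(SUP x\<in>B. \<bar>(c *\<^sub>R f) x\<bar>) = \<bar>c\<bar> * (SUP x\<in>B. \<bar>f x\<bar>)"
  proof (cases "c = 0")
    case True
    then show ?thesis using assms(2) by (simp add: scaleR_fun_def)
  next
    case False
    \<comment> \<open>The reverse inequality is \<open>le\<close> for the vector
      \<open>c *\<^sub>R f\<close> and the scalar \<open>inverse c\<close>.\<close>
    have "(SUP x\<in>B. \<bar>f x\<bar>) \<le> \<bar>inverse c\<bar> * (SUP x\<in>B. \<bar>(c *\<^sub>R f) x\<bar>)"
      using le[OF subspace_scale[OF subspace_topological_dual f], of "inverse c" c] False
      by simp
    then have "\<bar>c\<bar> * (SUP x\<in>B. \<bar>f x\<bar>) \<le> (SUP x\<in>B. \<bar>(c *\<^sub>R f) x\<bar>)"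
      using False by (simp add: field_simps abs_inverse)
    with le[OF f, of c] show ?thesis by simp
  qed
qed

text \<open>The source of all bidual elements below. A bound by finitely many suprema over bounded
  sets is continuity for the strong topology, and extension by 0 is the representation that
  \<open>topological_dual\<close> prescribes.\<close>

lemma functional_in_strong_bidual:
  assumes T: "0 \<in> topspace T"
    and lin: "linear_functional_on (topological_dual T) F"
    and Q: "finite Q" "\<And>B. B \<in> Q \<Longrightarrow> tvs_bounded T B \<and> B \<noteq> {}"
    and bound: "\<And>f. f \<in> topological_dual T \<Longrightarrow> \<bar>F f\<bar> \<le> C * (\<Sum>q\<in>(\<lambda>B f. SUP x\<in>B. \<bar>f x\<bar>) ` Q. q f)"
  shows "(\<lambda>f. if f \<in> topological_dual T then F f else 0) \<in> topological_dual (strong_dual T)"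
    (is "?G \<in> _")
proof -
  let ?P = "{\<lambda>f. SUP x\<in>B. \<bar>f x\<bar> | B. tvs_bounded T B \<and> B \<noteq> {}}"
  have lin': "linear_functional_on (topological_dual T) ?G"
    using lin subspace_add[OF subspace_topological_dual[of T]] subspace_scale[OF subspace_topological_dual[of T]]
    unfolding linear_functional_on_def by auto
  moreover have "continuous_map (seminorm_topology (topological_dual T) ?P) euclideanreal ?G"
  proof (rule continuous_map_linear_functional[OF subspace_topological_dual _ lin'])
    show "seminorm_on (topological_dual T) p" if "p \<in> ?P" for p
      using that seminorm_on_SUP_dual[OF _ _ T] by blast
    show "finite ((\<lambda>B f. SUP x\<in>B. \<bar>f x\<bar>) ` Q)" using Q by simp
    show "(\<lambda>B f. SUP x\<in>B. \<bar>f x\<bar>) ` Q \<subseteq> ?P" using Q(2) by blast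
    show "\<bar>?G f\<bar> \<le> C * (\<Sum>q\<in>(\<lambda>B f. SUP x\<in>B. \<bar>f x\<bar>) ` Q. q f)" if "f \<in> topological_dual T" for f
      using bound that by simp
  qed
  ultimately show ?thesis
    unfolding topological_dual_def[of "strong_dual T"] topspace_strong_dual
    unfolding strong_dual_def by auto
qed

text \<open>Restriction is the adjoint of the inclusion of \<open>W\<close>. Bounded subsets of
  \<open>W\<close> are bounded in the whole space, so restriction is strongly continuous, and a
  bidual element \<open>\<Psi>\<close> of \<open>W\<close> pulls back to the bidual element
  \<open>\<lambda>f. \<Psi> (r f)\<close>, on which the hypothesis can be tested.\<close>

lemma weakly_null_restrict:
  fixes T :: "'a::real_vector topology"
  assumes W: "subspace W" "W \<subseteq> topspace T"
    and \<phi>: "\<And>n. \<phi> n \<in> topological_dual T"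
    and lim: "limitin (weak_topology (strong_dual T)) \<phi> 0 F"
  defines "r \<equiv> \<lambda>f x. if x \<in> W then f x else (0::real)"
  shows "r (\<phi> n) \<in> topological_dual (subtopology T W)"
    and "limitin (weak_topology (strong_dual (subtopology T W))) (\<lambda>n. r (\<phi> n)) 0 F"
proof -
  let ?S = "subtopology T W"
  let ?sup = "\<lambda>B (f :: 'a \<Rightarrow> real). SUP x\<in>B. \<bar>f x\<bar>"
  let ?P = "{?sup B | B. tvs_bounded ?S B \<and> B \<noteq> {}}"
  have top: "topspace ?S = W" using W by auto
  have 0: "0 \<in> W" "0 \<in> topspace T" using W subspace_0 by auto
  have r: "r f \<in> topological_dual ?S" if "f \<in> topological_dual T" for f
  proof -
    have "continuous_map ?S euclideanreal (r f)"
      using continuous_map_eq[OF continuous_map_from_subtopology[OF topological_dual_continuous[OF that]], of W "r f"]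
      by (auto simp: r_def top)
    moreover have "linear_functional_on W (r f)"
      using topological_dual_linear[OF that] subsetD[OF W(2)] subspace_add[OF W(1)] subspace_scale[OF W(1)]
      unfolding linear_functional_on_def r_def by auto
    moreover have "r f x = 0" if "x \<notin> W" for x using that by (simp add: r_def)
    ultimately show ?thesis unfolding topological_dual_def top by blast
  qed
  then show "r (\<phi> n) \<in> topological_dual ?S" using \<phi> by blast
  have "((\<lambda>n. \<Psi> (r (\<phi> n))) \<longlongrightarrow> \<Psi> 0) F" if \<Psi>: "\<Psi> \<in> topological_dual (strong_dual ?S)" for \<Psi>
  proof -
    have lin\<Psi>: "linear_functional_on (topological_dual ?S) \<Psi>"
      using topological_dual_linear[OF \<Psi>] by (simp add: topspace_strong_dual)
    have P: "seminorm_on (topological_dual ?S) p" if "p \<in> ?P" for p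
      using that seminorm_on_SUP_dual[of ?S] 0 top by auto
    \<comment> \<open>The bound for continuous functionals is stated for a subtopology; here it is
      the one on the full dual.\<close>
    have "continuous_map (subtopology (seminorm_topology (topological_dual ?S) ?P) (topological_dual ?S)) euclideanreal \<Psi>"
      using continuous_map_from_subtopology[OF topological_dual_continuous[OF \<Psi>]]
      unfolding strong_dual_def .
    then obtain Q e where Q: "finite Q" "Q \<subseteq> ?P" "0 < e"
      "\<And>f. f \<in> topological_dual ?S \<Longrightarrow> \<bar>\<Psi> f\<bar> \<le> (\<Sum>q\<in>Q. q f) / e"
      using continuous_linear_functional_bound[OF subspace_topological_dual P lin\<Psi> subspace_topological_dual order_refl]
      by blast
    have QB: "Q \<subseteq> ?sup ` {B. tvs_bounded ?S B \<and> B \<noteq> {}}" using Q(2) by blast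
    obtain \<B> where \<B>: "\<B> \<subseteq> {B. tvs_bounded ?S B \<and> B \<noteq> {}}" "finite \<B>" "Q = ?sup ` \<B>"
      using finite_subset_image[OF Q(1) QB] by blast
    have bounded: "tvs_bounded T B" "B \<subseteq> W" if "B \<in> \<B>" for B
    proof -
      have B: "tvs_bounded ?S B" using that \<B> by blast
      then show BW: "B \<subseteq> W" unfolding tvs_bounded_def top by blast
      show "tvs_bounded T B"
        unfolding tvs_bounded_def
      proof (intro conjI allI impI)
        show "B \<subseteq> topspace T" using BW W by blast
        fix U assume "openin T U \<and> 0 \<in> U"
        then have "openin ?S (U \<inter> W) \<and> 0 \<in> U \<inter> W" using 0 openin_subtopology_Int by blast
        then show "\<exists>r>0. \<forall>t\<ge>r. B \<subseteq> (\<lambda>x. t *\<^sub>R x) ` U"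
          using B unfolding tvs_bounded_def by (meson Int_lower1 image_mono order_trans)
      qed
    qed
    have "linear_functional_on (topological_dual T) (\<lambda>f. \<Psi> (r f))"
    proof -
      have "r (f + g) = r f + r g" "r (c *\<^sub>R f) = c *\<^sub>R r f" for f g c
        by (auto simp: r_def fun_eq_iff scaleR_fun_def)
      then show ?thesis
        using lin\<Psi> r unfolding linear_functional_on_def by simp
    qed
    moreover have "\<bar>\<Psi> (r f)\<bar> \<le> (1 / e) * (\<Sum>q\<in>?sup ` \<B>. q f)" if "f \<in> topological_dual T" for f
    proof -
      \<comment> \<open>The sets in \<open>\<B>\<close> lie in \<open>W\<close>, where
        \<open>f\<close> and its restriction agree.\<close>
      have "?sup B (r f) = ?sup B f" if "B \<in> \<B>" for B
        using bounded[OF that] by (intro SUP_cong) (auto simp: r_def)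
      then have "(\<Sum>q\<in>?sup ` \<B>. q (r f)) = (\<Sum>q\<in>?sup ` \<B>. q f)"
        by (intro sum.cong) auto
      then show ?thesis using Q(4)[OF r[OF that]] \<B> by simp
    qed
    ultimately have "(\<lambda>f. if f \<in> topological_dual T then \<Psi> (r f) else 0) \<in> topological_dual (strong_dual T)"
      (is "?G \<in> _")
      using \<B> bounded by (intro functional_in_strong_bidual[OF 0(2), where Q = \<B> and C = "1 / e"]) auto
    then have "((\<lambda>n. ?G (\<phi> n)) \<longlongrightarrow> ?G 0) F"
      using conjunct2[OF conjunct2[OF lim[unfolded limitin_weak_topology]]] by (rule bspec[rotated])
    moreover have "r 0 = 0" by (auto simp: r_def fun_eq_iff)
    ultimately show ?thesis using \<phi> zero_in_topological_dual[of T] by simp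
  qed
  then show "limitin (weak_topology (strong_dual ?S)) (\<lambda>n. r (\<phi> n)) 0 F"
    using r \<phi> by (simp add: limitin_weak_topology topspace_strong_dual zero_in_topological_dual)
qed

section \<open>Countable neighbourhood bases\<close>

text \<open>The metric supplied by \<open>metrizable_space\<close> need not respect the linear
  structure, so only a countable neighbourhood base is kept of it. Monotonicity lets membership in
  one \<open>U n\<close> imply membership in all earlier ones.\<close>

lemma metrizable_decreasing_base:
  assumes "metrizable_space T" "a \<in> topspace T"
  obtains U :: "nat \<Rightarrow> 'a set" where "\<forall>n. openin T (U n) \<and> a \<in> U n" "decseq U"
    "\<forall>W. openin T W \<and> a \<in> W \<longrightarrow> (\<exists>n. U n \<subseteq> W)"
proof -
  obtain M d where "Metric_space M d" and T: "T = Metric_space.mtopology M d"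
    using assms(1) unfolding metrizable_space_def by blast
  interpret Metric_space M d by fact
  have a: "a \<in> M" using assms(2) T by simp
  show ?thesis
  proof (rule that[of "\<lambda>n. mball a (inverse (Suc n))"])
    show "decseq (\<lambda>n. mball a (inverse (Suc n)))"
      by (intro decseq_SucI mball_subset_concentric) (simp add: field_simps)
  next
    have "\<exists>n. mball a (inverse (Suc n)) \<subseteq> W" if W: "openin T W" "a \<in> W" for W
    proof -
      obtain e where e: "0 < e" "mball a e \<subseteq> W" using W unfolding T openin_mtopology by blast
      obtain n where "inverse (real (Suc n)) < e" using reals_Archimedean e(1) by blast
      then have "mball a (inverse (Suc n)) \<subseteq> W"
        using e(2) mball_subset_concentric[of "inverse (real (Suc n))" e a] by auto
      then show ?thesis by blast
    qed
    then show "\<forall>W. openin T W \<and> a \<in> W \<longrightarrow> (\<exists>n. mball a (inverse (Suc n)) \<subseteq> W)" by blast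
  qed (use a T in auto)
qed

text \<open>The quotient map is open, so the coset of \<open>x n\<close> eventually meets any given
  neighbourhood of 0. Picking \<open>u n\<close> in the smallest of \<open>U 0\<close>, ...,
  \<open>U n\<close> that this coset meets gives a null sequence of representatives.\<close>

lemma quotient_null_lift:
  fixes P :: "('a::real_vector \<Rightarrow> real) set" and x :: "nat \<Rightarrow> 'a"
  defines "T \<equiv> seminorm_topology UNIV P"
  assumes "metrizable_space T" and I: "subspace I"
    and lim: "limitin (quotient_topology T (coset I)) (\<lambda>n. coset I (x n)) (coset I 0) sequentially"
  obtains u where "\<And>n. x n - u n \<in> I" "limitin T u 0 sequentially"
proof -
  have top: "topspace T = UNIV" by (simp add: T_def topspace_seminorm_topology)
  have eq: "coset I a = coset I b \<longleftrightarrow> a - b \<in> I" for a b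
  proof
    have "a \<in> coset I a" using I by (simp add: coset_def subspace_0)
    then show "a - b \<in> I" if "coset I a = coset I b" unfolding that by (simp add: coset_def)
    assume ab: "a - b \<in> I"
    have "y - a \<in> I \<longleftrightarrow> y - b \<in> I" for y
      using subspace_add[OF I _ ab, of "y - a"] subspace_diff[OF I _ ab, of "y - b"] by auto
    then show "coset I a = coset I b" by (simp add: coset_def)
  qed
  \<comment> \<open>Translates of subbasic balls are subbasic balls, so translations are
    continuous.\<close>
  have shift: "openin T {y. y - i \<in> U}" if "openin T U" for U i
  proof -
    have "continuous_map T T (\<lambda>y. y - i)"
      unfolding seminorm_topology_def T_def
    proof (rule continuous_on_generated_topo; fold seminorm_topology_def; fold T_def)
      fix W assume W: "W \<in> insert UNIV {{y \<in> UNIV. p (y - x) < e} | p x e. p \<in> P \<and> x \<in> UNIV \<and> 0 < e}"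
      show "openin T ((\<lambda>y. y - i) -` W \<inter> topspace T)"
      proof (cases "W = UNIV")
        case True
        then show ?thesis by simp
      next
        case False
        with W obtain p a e where p: "p \<in> P" "0 < e" and W: "W = {y. p (y - a) < e}" by auto
        have "(\<lambda>y. y - i) -` W \<inter> topspace T = {y \<in> UNIV. p (y - (i + a)) < e}"
          by (auto simp: W top diff_diff_eq)
        then show ?thesis unfolding T_def using openin_seminorm_ball[OF p(1) UNIV_I p(2)] by simp
      qed
    qed auto
    then show ?thesis using openin_continuous_map_preimage[OF _ that] top by fastforce
  qed
  have hits: "\<forall>\<^sub>F n in sequentially. \<exists>w\<in>U. x n - w \<in> I" if U: "openin T U" "0 \<in> U" for U
  proof -
    \<comment> \<open>The saturation of \<open>U\<close> is the union of its translates by elements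
      of \<open>I\<close>, hence open.\<close>
    have "{y. coset I y \<in> coset I ` U} = (\<Union>i\<in>I. {y. y - i \<in> U})"
    proof safe
      fix y w assume "coset I y = coset I w" "w \<in> U"
      then show "y \<in> (\<Union>i\<in>I. {y. y - i \<in> U})" by (intro UN_I[of "y - w"]) (auto simp: eq)
    next
      fix y i assume "i \<in> I" "y - i \<in> U"
      then show "coset I y \<in> coset I ` U" by (intro image_eqI[of _ _ "y - i"]) (auto simp: eq)
    qed
    then have "openin T {y. coset I y \<in> coset I ` U}" using shift[OF U(1)] by auto
    then have "openin (quotient_topology T (coset I)) (coset I ` U)"
      by (auto simp: openin_quotient_topology top)
    then have "\<forall>\<^sub>F n in sequentially. coset I (x n) \<in> coset I ` U"
      using lim U(2) unfolding limitin_def by blast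
    then show ?thesis by (rule eventually_mono) (auto simp: eq)
  qed
  have "0 \<in> topspace T" by (simp add: top)
  then obtain U where U: "\<forall>n. openin T (U n) \<and> 0 \<in> U n" "decseq U"
    "\<forall>W. openin T W \<and> 0 \<in> W \<longrightarrow> (\<exists>n. U n \<subseteq> W)"
    using metrizable_decreasing_base[OF assms(2)] by blast
  \<comment> \<open>If the coset meets the last set, that witness serves every earlier
    \<open>k\<close> because \<open>U\<close> decreases; otherwise the earlier choice is kept. The
    bound \<open>N\<close> will be taken equal to \<open>n\<close>.\<close>
  have lift: "\<exists>w. x n - w \<in> I \<and> (\<forall>k\<le>N. (\<exists>w'\<in>U k. x n - w' \<in> I) \<longrightarrow> w \<in> U k)" for n N
  proof (induction N)
    case 0
    have "x n - x n \<in> I" using I subspace_0 by simp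
    then show ?case by (metis le_zero_eq)
  next
    case (Suc N)
    show ?case
    proof (cases "\<exists>w'\<in>U (Suc N). x n - w' \<in> I")
      case True
      then show ?thesis using decseqD[OF U(2)] by blast
    next
      case False
      then show ?thesis using Suc by (metis le_Suc_eq)
    qed
  qed
  have "\<exists>u. \<forall>n. x n - u n \<in> I \<and> (\<forall>k\<le>n. (\<exists>w'\<in>U k. x n - w' \<in> I) \<longrightarrow> u n \<in> U k)"
    by (rule choice) (rule allI, rule lift)
  then obtain u where u: "\<forall>n. x n - u n \<in> I \<and> (\<forall>k\<le>n. (\<exists>w'\<in>U k. x n - w' \<in> I) \<longrightarrow> u n \<in> U k)" ..
  have "\<forall>\<^sub>F n in sequentially. u n \<in> W" if W: "openin T W" "0 \<in> W" for W
  proof -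
    obtain k where k: "U k \<subseteq> W" using U(3) W by blast
    have "\<forall>\<^sub>F n in sequentially. \<exists>w\<in>U k. x n - w \<in> I"
      by (rule hits) (use U(1) in auto)
    moreover have "\<forall>\<^sub>F n in sequentially. k \<le> n" by (rule eventually_ge_at_top)
    ultimately show ?thesis
      by eventually_elim (use u k in blast)
  qed
  then have "limitin T u 0 sequentially" by (simp add: limitin_def top)
  with u that show ?thesis by blast
qed

section \<open>Positive extension of functionals from an ideal\<close>

lemma riesz_seminormD:
  assumes "riesz_seminorm p"
  shows riesz_seminorm_mono: "\<bar>x\<bar> \<le> \<bar>y\<bar> \<Longrightarrow> p x \<le> p y"
    and riesz_seminorm_seminorm_on: "seminorm_on UNIV p"
  using assms unfolding riesz_seminorm_def seminorm_on_def by blast+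

text \<open>The order-free part of the additivity of \<open>s\<close> in the next lemma, where
  \<open>A\<close>, \<open>B\<close>, \<open>C\<close> are the positive elements of the ideal below
  \<open>a\<close>, \<open>b\<close> and \<open>a + b\<close>.\<close>

lemma cSUP_additive:
  fixes f :: "'a \<Rightarrow> real"
  assumes "A \<noteq> {}" "B \<noteq> {}" "bdd_above (f ` C)"
    and le: "\<And>a b. a \<in> A \<Longrightarrow> b \<in> B \<Longrightarrow> \<exists>c\<in>C. f a + f b \<le> f c"
    and bdd: "bdd_above (f ` A)" "bdd_above (f ` B)"
    and ge: "\<And>c. c \<in> C \<Longrightarrow> \<exists>a\<in>A. \<exists>b\<in>B. f c \<le> f a + f b"
  shows "(SUP c\<in>C. f c) = (SUP a\<in>A. f a) + (SUP b\<in>B. f b)"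
proof (rule antisym)
  have "C \<noteq> {}" using assms(1,2) le by blast
  then show "(SUP c\<in>C. f c) \<le> (SUP a\<in>A. f a) + (SUP b\<in>B. f b)"
  proof (rule cSUP_least)
    fix c assume "c \<in> C"
    then obtain a b where ab: "a \<in> A" "b \<in> B" "f c \<le> f a + f b" using ge by blast
    have "f a \<le> (SUP a\<in>A. f a)" "f b \<le> (SUP b\<in>B. f b)"
      using ab bdd by (auto intro: cSUP_upper)
    with ab(3) show "f c \<le> (SUP a\<in>A. f a) + (SUP b\<in>B. f b)" by linarith
  qed
  have "(SUP a\<in>A. f a) \<le> (SUP c\<in>C. f c) - f b" if b: "b \<in> B" for b
  proof (rule cSUP_least[OF assms(1)])
    fix a assume "a \<in> A"
    then obtain c where "c \<in> C" "f a + f b \<le> f c" using le b by blast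
    then show "f a \<le> (SUP c\<in>C. f c) - f b"
      using cSUP_upper[OF _ assms(3), of c] by linarith
  qed
  then have "(SUP b\<in>B. f b) \<le> (SUP c\<in>C. f c) - (SUP a\<in>A. f a)"
    by (intro cSUP_least[OF assms(2)]) (simp add: algebra_simps)
  then show "(SUP a\<in>A. f a) + (SUP b\<in>B. f b) \<le> (SUP c\<in>C. f c)" by simp
qed

text \<open>
  The majorant is \<open>x \<mapsto> sup {f y | y \<in> I, 0 \<le> y \<le> x}\<close> on the positive cone; taking it for \<open>f\<close> and
  \<open>- f\<close> takes the place of a Hahn-Banach extension of \<open>f\<close>.
\<close>

lemma riesz_ideal_functional_majorant:
  fixes I :: "'a::riesz_space set"
  assumes I: "riesz_ideal I" and f: "linear_functional_on I f"
    and p: "riesz_seminorm p" and fp: "\<And>y. y \<in> I \<Longrightarrow> f y \<le> p y"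
  obtains g where "linear_functional_on UNIV g" "\<forall>x. \<bar>g x\<bar> \<le> 2 * p x"
    "\<forall>y\<in>I. \<forall>x. 0 \<le> y \<and> y \<le> x \<longrightarrow> f y \<le> g x"
proof -
  have sub: "subspace I" and solid: "\<And>x y. y \<in> I \<Longrightarrow> \<bar>x\<bar> \<le> \<bar>y\<bar> \<Longrightarrow> x \<in> I"
    using I unfolding riesz_ideal_def by blast+
  have dom: "y \<in> I" if "0 \<le> y" "y \<le> z" "z \<in> I" for y z
    using solid[OF that(3), of y] that by (simp add: abs_of_nonneg)
  have f0: "f 0 = 0"
    using linear_functional_on_diff[OF f sub] subspace_0[OF sub] by (metis diff_self)
  define S where "S x = {y \<in> I. 0 \<le> y \<and> y \<le> x}" for x
  define s where "s x = (SUP y\<in>S x. f y)" for x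
  have S0: "0 \<in> S x" if "0 \<le> x" for x
    using that subspace_0[OF sub] by (simp add: S_def)
  have le_p: "f y \<le> p x" if "y \<in> S x" for x y
  proof -
    have "f y \<le> p y" using fp that by (simp add: S_def)
    also have "\<dots> \<le> p x"
      using that by (intro riesz_seminorm_mono[OF p]) (auto simp: S_def abs_of_nonneg)
    finally show ?thesis .
  qed
  have bdd: "bdd_above (f ` S x)" for x using le_p by (intro bdd_aboveI[of _ "p x"]) blast
  have s_ge: "f y \<le> s x" if "y \<in> S x" for x y
    unfolding s_def using that bdd by (rule cSUP_upper)
  have s_nonneg: "0 \<le> s x" if "0 \<le> x" for x
    using s_ge[OF S0[OF that]] f0 by simp
  have s_le: "s x \<le> p x" if "0 \<le> x" for x
    unfolding s_def using S0[OF that] le_p by (intro cSUP_least) auto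
  have s_add: "s (a + b) = s a + s b" if ab: "0 \<le> a" "0 \<le> b" for a b
    unfolding s_def
  proof (rule cSUP_additive)
    show "S a \<noteq> {}" "S b \<noteq> {}" using S0 ab by blast+
    fix y z assume yz: "y \<in> S a" "z \<in> S b"
    then have "y + z \<in> S (a + b)"
      using subspace_add[OF sub] by (auto simp: S_def intro: add_mono)
    moreover have "f (y + z) = f y + f z"
      using f yz unfolding linear_functional_on_def S_def by blast
    ultimately show "\<exists>c\<in>S (a + b). f y + f z \<le> f c" by (metis order_refl)
  next
    fix c assume c: "c \<in> S (a + b)"
    \<comment> \<open>Riesz decomposition: \<open>c \<le> a + b\<close> splits into
      \<open>inf c a\<close> and the remainder \<open>sup 0 (c - a)\<close>, which is at most
      \<open>b\<close>.\<close>
    define y where "y = inf c a"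
    have y: "0 \<le> y" "y \<le> c" "y \<le> a" using c ab by (auto simp: y_def S_def)
    have "c - y = sup 0 (c - a)"
      unfolding y_def by (simp add: diff_inf_eq_sup add_sup_distrib_left)
    also have "\<dots> \<le> b" using c ab by (auto simp: S_def algebra_simps)
    finally have z: "c - y \<le> b" "0 \<le> c - y" "c - y \<le> c" using y by auto
    have "c \<in> I" using c by (simp add: S_def)
    then have "y \<in> I" "c - y \<in> I" using dom y z by blast+
    then have "y \<in> S a" "c - y \<in> S b" using y z by (auto simp: S_def)
    moreover have "f c = f y + f (c - y)"
      using linear_functional_on_diff[OF f sub \<open>c \<in> I\<close> \<open>y \<in> I\<close>] by simp
    ultimately show "\<exists>y\<in>S a. \<exists>z\<in>S b. f c \<le> f y + f z" by (metis order_refl)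
  qed (rule bdd)+
  have s_scale_le: "s (c *\<^sub>R x) \<le> c * s x" if c: "0 < c" and x: "0 \<le> x" for c x
  proof -
    have "0 \<le> c *\<^sub>R x" using c x by (simp add: scaleR_nonneg_nonneg)
    moreover have "f y \<le> c * s x" if y: "y \<in> S (c *\<^sub>R x)" for y
    proof -
      have "inverse c *\<^sub>R y \<le> inverse c *\<^sub>R (c *\<^sub>R x)"
        using y c by (intro scaleR_left_mono) (auto simp: S_def)
      then have "inverse c *\<^sub>R y \<in> S x"
        using y c subspace_scale[OF sub] by (auto simp: S_def scaleR_nonneg_nonneg)
      then have "f (inverse c *\<^sub>R y) \<le> s x" by (rule s_ge)
      moreover have "f (inverse c *\<^sub>R y) = inverse c * f y"
        using f y unfolding linear_functional_on_def S_def by blast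
      ultimately have "inverse c * f y \<le> s x" by simp
      then show ?thesis using c by (simp add: field_simps)
    qed
    ultimately show ?thesis unfolding s_def[of "c *\<^sub>R x"] using S0 by (intro cSUP_least) auto
  qed
  have s_scale: "s (c *\<^sub>R x) = c * s x" if c: "0 \<le> c" and x: "0 \<le> x" for c x
  proof (cases "c = 0")
    case True
    then show ?thesis using s_add[of 0 0] by simp
  next
    case False
    then have c: "0 < c" using c by simp
    \<comment> \<open>The estimate just proved, applied to \<open>inverse c\<close> and
      \<open>c *\<^sub>R x\<close>, is the opposite inequality.\<close>
    have "s (inverse c *\<^sub>R (c *\<^sub>R x)) \<le> inverse c * s (c *\<^sub>R x)"
      using c x by (intro s_scale_le) (auto simp: scaleR_nonneg_nonneg)
    then have "c * s x \<le> s (c *\<^sub>R x)" using c by (simp add: field_simps)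
    with s_scale_le[OF c x] show ?thesis by simp
  qed
  \<comment> \<open>The usual extension from the positive cone: \<open>nprt\<close> is nonpositive,
    so \<open>x\<close> is a difference of two positive vectors. By \<open>g_diff\<close> any other
    such difference gives the same value, and linearity follows from that.\<close>
  define g where "g x = s (pprt x) - s (- nprt x)" for x
  have g_diff: "g (a - b) = s a - s b" if "0 \<le> a" "0 \<le> b" for a b
  proof -
    have "pprt (a - b) + b = a + (- nprt (a - b))"
      using prts[of "a - b"] by (simp add: algebra_simps)
    then have "s (pprt (a - b)) + s b = s a + s (- nprt (a - b))"
      using s_add[of "pprt (a - b)" b] s_add[of a "- nprt (a - b)"] that by simp
    then show ?thesis by (simp add: g_def)
  qed
  have "g (x + y) = g x + g y" for x y
  proof -
    have "x + y = (pprt x + nprt x) + (pprt y + nprt y)" by (simp only: prts[symmetric])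
    also have "\<dots> = (pprt x + pprt y) - (- nprt x + - nprt y)" by (simp add: algebra_simps)
    finally have "x + y = (pprt x + pprt y) - (- nprt x + - nprt y)" .
    then have "g (x + y) = s (pprt x + pprt y) - s (- nprt x + - nprt y)"
      by (simp only: g_diff add_nonneg_nonneg zero_le_pprt neg_0_le_iff_le nprt_le_zero)
    then show ?thesis
      using s_add[of "pprt x" "pprt y"] s_add[of "- nprt x" "- nprt y"] by (simp add: g_def)
  qed
  moreover have "g (c *\<^sub>R x) = c * g x" for c x
  proof (cases "0 \<le> c")
    case True
    have "c *\<^sub>R x = c *\<^sub>R pprt x - c *\<^sub>R (- nprt x)"
      by (subst prts[of x]) (simp add: algebra_simps)
    then have "g (c *\<^sub>R x) = s (c *\<^sub>R pprt x) - s (c *\<^sub>R (- nprt x))"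
      using g_diff[of "c *\<^sub>R pprt x" "c *\<^sub>R (- nprt x)"] True by (simp add: scaleR_nonneg_nonneg scaleR_nonneg_nonpos)
    also have "\<dots> = c * s (pprt x) - c * s (- nprt x)"
      using True by (subst (1 2) s_scale) auto
    finally show ?thesis by (simp add: g_def algebra_simps)
  next
    case False
    have "c *\<^sub>R x = (- c) *\<^sub>R (- nprt x) - (- c) *\<^sub>R pprt x"
      by (subst prts[of x]) (simp add: algebra_simps)
    then have "g (c *\<^sub>R x) = s ((- c) *\<^sub>R (- nprt x)) - s ((- c) *\<^sub>R pprt x)"
      using g_diff[of "(- c) *\<^sub>R (- nprt x)" "(- c) *\<^sub>R pprt x"] False
      by (metis linear neg_0_le_iff_le nprt_le_zero scaleR_nonneg_nonneg zero_le_pprt)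
    also have "\<dots> = (- c) * s (- nprt x) - (- c) * s (pprt x)"
      using False by (subst (1 2) s_scale) auto
    finally show ?thesis by (simp add: g_def algebra_simps)
  qed
  ultimately have "linear_functional_on UNIV g" by (simp add: linear_functional_on_def)
  \<comment> \<open>The factor 2 counts one \<open>p x\<close> for the positive part and one for the
    negative part.\<close>
  moreover have "\<bar>g x\<bar> \<le> 2 * p x" for x
  proof -
    have "p (pprt x) \<le> p x" "p (- nprt x) \<le> p x"
      by (intro riesz_seminorm_mono[OF p]; simp add: abs_of_nonneg abs_prts)+
    moreover have "s (pprt x) \<le> p (pprt x)" "s (- nprt x) \<le> p (- nprt x)"
      "0 \<le> s (pprt x)" "0 \<le> s (- nprt x)"
      by (intro s_le s_nonneg; simp)+
    ultimately show ?thesis unfolding g_def by linarith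
  qed
  moreover have "f y \<le> g x" if "y \<in> I" "0 \<le> y" "y \<le> x" for x y
  proof -
    have "0 \<le> x" using that by order
    then have "g x = s x" using g_diff[of x 0] s_add[of 0 0] by simp
    then show ?thesis using s_ge[of y x] that by (simp add: S_def)
  qed
  ultimately show ?thesis by (intro that) auto
qed

text \<open>Majorants \<open>h\<close> of \<open>f\<close> and \<open>k\<close> of
  \<open>- f\<close> give \<open>- k (x n) \<le> f (v n) \<le> h (x n)\<close>, and both outer terms
  tend to 0 because \<open>h\<close> and \<open>k\<close> are continuous functionals on the whole
  space.\<close>

lemma weakly_null_dominated_in_ideal:
  fixes P :: "('a::riesz_space \<Rightarrow> real) set"
  assumes I: "riesz_ideal I" and P: "\<And>p. p \<in> P \<Longrightarrow> riesz_seminorm p"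
    and lim: "limitin (weak_topology (seminorm_topology UNIV P)) x 0 F"
    and v: "\<And>n. v n \<in> I" "\<And>n. 0 \<le> v n" "\<And>n. v n \<le> x n"
  shows "limitin (weak_topology (subtopology (seminorm_topology UNIV P) I)) v 0 F"
proof -
  let ?T = "seminorm_topology UNIV P"
  have sub: "subspace I" using I by (simp add: riesz_ideal_def)
  have top: "topspace (subtopology ?T I) = I" by (simp add: topspace_seminorm_topology)
  have P': "seminorm_on UNIV p" if "p \<in> P" for p using riesz_seminorm_seminorm_on P that by blast
  have majorant: "\<exists>h. ((\<lambda>n. h (x n)) \<longlongrightarrow> 0) F \<and> (\<forall>n. f (v n) \<le> h (x n))"
    if f: "f \<in> topological_dual (subtopology ?T I)" for f :: "'a \<Rightarrow> real"
  proof -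
    have lin: "linear_functional_on I f" using topological_dual_linear[OF f] top by simp
    obtain Q e where Q: "finite Q" "Q \<subseteq> P" "0 < (e::real)" "\<And>y. y \<in> I \<Longrightarrow> \<bar>f y\<bar> \<le> (\<Sum>q\<in>Q. q y) / e"
      using continuous_linear_functional_bound[OF subspace_UNIV P' lin sub subset_UNIV
          topological_dual_continuous[OF f]] by blast
    \<comment> \<open>The finitely many seminorms that bound \<open>f\<close> are merged into one
      Riesz seminorm, as the majorant is built from a single \<open>p\<close>.\<close>
    define p where "p y = (\<Sum>q\<in>Q. q y) / e" for y
    have "riesz_seminorm p"
      unfolding riesz_seminorm_def
    proof (intro conjI allI impI)
      show "p (a + b) \<le> p a + p b" for a b
        unfolding p_def add_divide_distrib[symmetric] sum.distrib[symmetric]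
        using Q P by (intro divide_right_mono sum_mono) (auto simp: riesz_seminorm_def)
      show "p (c *\<^sub>R a) = \<bar>c\<bar> * p a" for c a
      proof -
        have "(\<Sum>q\<in>Q. q (c *\<^sub>R a)) = (\<Sum>q\<in>Q. \<bar>c\<bar> * q a)"
          using Q P by (intro sum.cong) (auto simp: riesz_seminorm_def)
        then show ?thesis by (simp add: p_def sum_distrib_left)
      qed
      show "p a \<le> p b" if "\<bar>a\<bar> \<le> \<bar>b\<bar>" for a b
        unfolding p_def using Q P that
        by (intro divide_right_mono sum_mono) (auto intro: riesz_seminorm_mono)
    qed
    moreover have "f y \<le> p y" if "y \<in> I" for y using Q(4)[OF that] by (simp add: p_def)
    ultimately obtain g where g: "linear_functional_on UNIV g" "\<forall>x. \<bar>g x\<bar> \<le> 2 * p x"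
      "\<forall>y\<in>I. \<forall>x. 0 \<le> y \<and> y \<le> x \<longrightarrow> f y \<le> g x"
      using riesz_ideal_functional_majorant[OF I lin] by blast
    have "continuous_map ?T euclideanreal g"
      by (rule continuous_map_linear_functional[OF subspace_UNIV P' g(1) Q(1,2), of "2 / e"])
        (use g(2) in \<open>simp_all add: p_def\<close>)
    then have "g \<in> topological_dual ?T"
      using g(1) by (simp add: topological_dual_def topspace_seminorm_topology)
    then have "((\<lambda>n. g (x n)) \<longlongrightarrow> g 0) F"
      using lim unfolding limitin_weak_topology by blast
    moreover have "g 0 = 0"
      using linear_functional_on_diff[OF g(1) subspace_UNIV, of 0 0] by simp
    ultimately show ?thesis using g(3) v by (intro exI[of _ g]) auto
  qed
  have "((\<lambda>n. f (v n)) \<longlongrightarrow> f 0) F" if f: "f \<in> topological_dual (subtopology ?T I)" for f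
  proof -
    have "- f \<in> topological_dual (subtopology ?T I)"
      using subspace_neg[OF subspace_topological_dual f] .
    then obtain h k where h: "((\<lambda>n. h (x n)) \<longlongrightarrow> 0) F" "\<forall>n. f (v n) \<le> h (x n)"
      and k: "((\<lambda>n. k (x n)) \<longlongrightarrow> 0) F" "\<forall>n. (- f) (v n) \<le> k (x n)"
      using majorant[OF f] majorant[of "- f"] by blast
    have "((\<lambda>n. f (v n)) \<longlongrightarrow> 0) F"
    proof (rule tendsto_sandwich)
      show "((\<lambda>n. - k (x n)) \<longlongrightarrow> 0) F" using tendsto_minus[OF k(1)] by simp
      show "\<forall>\<^sub>F n in F. - k (x n) \<le> f (v n)"
        using k(2) by (auto simp: minus_le_iff)
    qed (use h in auto)
    moreover have "f 0 = 0"
      using linear_functional_on_diff[OF topological_dual_linear[OF f, unfolded top] sub, of 0 0]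
        subspace_0[OF sub] by simp
    ultimately show ?thesis by simp
  qed
  then show ?thesis
    using v(1) subspace_0[OF sub] by (simp add: limitin_weak_topology topspace_seminorm_topology)
qed

section \<open>Weakly null sequences of functionals\<close>

lemma linear_functional_sum:
  fixes n :: nat
  assumes "linear_functional_on UNIV f"
  shows "f (\<Sum>j<n. z j) = (\<Sum>j<n. f (z j))"
proof (induction n)
  case 0
  show ?case using linear_functional_on_diff[OF assms subspace_UNIV, of 0 0] by simp
next
  case (Suc n)
  then show ?case using assms by (simp add: linear_functional_on_def)
qed

lemma summable_dual:
  fixes P :: "('a::real_vector \<Rightarrow> real) set" and z :: "nat \<Rightarrow> 'a"
  assumes P: "\<And>p. p \<in> P \<Longrightarrow> seminorm_on UNIV p"
    and z: "\<And>p. p \<in> P \<Longrightarrow> summable (\<lambda>j. p (z j))"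
    and f: "f \<in> topological_dual (seminorm_topology UNIV P)"
  shows "summable (\<lambda>j. f (z j))"
proof -
  have lin: "linear_functional_on UNIV f"
    using topological_dual_linear[OF f] by (simp add: topspace_seminorm_topology)
  obtain Q e where Q: "finite Q" "Q \<subseteq> P" "0 < (e::real)" "\<And>y. y \<in> UNIV \<Longrightarrow> \<bar>f y\<bar> \<le> (\<Sum>q\<in>Q. q y) / e"
    using continuous_linear_functional_bound[OF subspace_UNIV P lin subspace_UNIV order_refl
        continuous_map_from_subtopology[OF topological_dual_continuous[OF f]]] by blast
  have "summable (\<lambda>j. (\<Sum>q\<in>Q. q (z j)) / e)"
    using z Q(2) by (intro summable_divide summable_sum) blast
  then show ?thesis
    by (rule summable_comparison_test') (use Q(4) in auto)
qed

text \<open>The partial sums form a bounded set, since each \<open>p\<close> is at most the sum of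
  the \<open>p (z j)\<close> on them. The supremum of \<open>\<bar>f x\<bar>\<close> over this set
  bounds the limit of the values of \<open>f\<close> at the partial sums.\<close>

lemma series_in_strong_bidual:
  fixes P :: "('a::real_vector \<Rightarrow> real) set" and z :: "nat \<Rightarrow> 'a"
  defines "T \<equiv> seminorm_topology UNIV P"
  assumes P: "\<And>p. p \<in> P \<Longrightarrow> seminorm_on UNIV p"
    and z: "\<And>p. p \<in> P \<Longrightarrow> summable (\<lambda>j. p (z j))"
  shows "(\<lambda>f. if f \<in> topological_dual T then \<Sum>j. f (z j) else 0) \<in> topological_dual (strong_dual T)"
proof -
  have top: "topspace T = UNIV" by (simp add: T_def topspace_seminorm_topology)
  note summable = summable_dual[where P = P and z = z, OF P z, folded T_def]
  let ?B = "range (\<lambda>N. \<Sum>j<N. z j)"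
  have B: "tvs_bounded T ?B"
    unfolding T_def
  proof (rule tvs_bounded_seminorm_topology[OF P])
    fix p assume p: "p \<in> P"
    have nonneg: "0 \<le> p y" for y using seminorm_on_nonneg[OF P[OF p] subspace_UNIV] by simp
    have "p (\<Sum>j<N. z j) \<le> (\<Sum>j. p (z j))" for N
    proof -
      have "p (\<Sum>j<N. z j) \<le> (\<Sum>j<N. p (z j))"
      proof (induction N)
        case 0
        then show ?case using seminorm_on_zero[OF P[OF p] UNIV_I] by simp
      next
        case (Suc N)
        then show ?case
          using seminorm_on_triangle[OF P[OF p] UNIV_I UNIV_I, of "\<Sum>j<N. z j" "z N"] by simp
      qed
      also have "\<dots> \<le> (\<Sum>j. p (z j))"
        using z[OF p] nonneg by (intro sum_le_suminf) auto
      finally show ?thesis .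
    qed
    then show "\<exists>M. \<forall>x\<in>?B. p x \<le> M" by blast
  qed
  show ?thesis
  proof (rule functional_in_strong_bidual[where Q = "{?B}" and C = 1])
    show "linear_functional_on (topological_dual T) (\<lambda>f. \<Sum>j. f (z j))"
      unfolding linear_functional_on_def
      using suminf_add[OF summable summable] suminf_mult[OF summable]
      by (simp add: scaleR_fun_def)
    fix f assume f: "f \<in> topological_dual T"
    have lin: "linear_functional_on UNIV f" using topological_dual_linear[OF f] by (simp add: top)
    have "(\<lambda>N. \<bar>f (\<Sum>j<N. z j)\<bar>) \<longlonglongrightarrow> \<bar>\<Sum>j. f (z j)\<bar>"
      unfolding linear_functional_sum[OF lin] by (intro tendsto_rabs summable_LIMSEQ summable f)
    moreover have "\<bar>f (\<Sum>j<N. z j)\<bar> \<le> (SUP x\<in>?B. \<bar>f x\<bar>)" for N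
      using topological_dual_bounded[OF B _ f] top by (intro cSUP_upper) auto
    ultimately have "\<bar>\<Sum>j. f (z j)\<bar> \<le> (SUP x\<in>?B. \<bar>f x\<bar>)"
      by (intro LIMSEQ_le_const2) auto
    then show "\<bar>\<Sum>j. f (z j)\<bar> \<le> 1 * (\<Sum>q\<in>(\<lambda>B f. SUP x\<in>B. \<bar>f x\<bar>) ` {?B}. q f)" by simp
  qed (use top B in auto)
qed

lemma weakly_null_functionals_on_series:
  fixes P :: "('a::real_vector \<Rightarrow> real) set"
  assumes P: "\<And>p. p \<in> P \<Longrightarrow> seminorm_on UNIV p"
    and \<phi>: "\<And>n. \<phi> n \<in> topological_dual (seminorm_topology UNIV P)"
    and lim: "limitin (weak_topology (strong_dual (seminorm_topology UNIV P))) \<phi> 0 F"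
    and z: "\<And>p. p \<in> P \<Longrightarrow> summable (\<lambda>j::nat. p (z j))"
  shows "((\<lambda>n. \<Sum>j. \<phi> n (z j)) \<longlongrightarrow> 0) F"
proof -
  let ?G = "\<lambda>f. if f \<in> topological_dual (seminorm_topology UNIV P) then \<Sum>j. f (z j) else 0"
  have "?G \<in> topological_dual (strong_dual (seminorm_topology UNIV P))"
    by (rule series_in_strong_bidual[OF P z])
  then have "((\<lambda>n. ?G (\<phi> n)) \<longlongrightarrow> ?G 0) F"
    using conjunct2[OF conjunct2[OF lim[unfolded limitin_weak_topology]]] by (rule bspec[rotated])
  then show ?thesis using \<phi> zero_in_topological_dual[of "seminorm_topology UNIV P"] by simp
qed

text \<open>
  A gliding hump in place of the Banach-Steinhaus theorem: along a sparse subsequence \<open>k\<close>, the absolutely convergent series of the \<open>y (k j)\<close> is an element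
  of the bidual on which \<open>\<phi> (k i)\<close> takes a value close to \<open>\<phi> (k i) (y (k i))\<close>.
\<close>

lemma weakly_null_functionals_on_null_sequence:
  fixes P :: "('a::real_vector \<Rightarrow> real) set"
  defines "T \<equiv> seminorm_topology UNIV P"
  assumes P: "\<And>p. p \<in> P \<Longrightarrow> seminorm_on UNIV p" and met: "metrizable_space T"
    and \<phi>: "\<And>n. \<phi> n \<in> topological_dual T"
    and lim: "limitin (weak_topology (strong_dual T)) \<phi> 0 sequentially"
    and y: "limitin T y 0 sequentially"
  shows "(\<lambda>n. \<phi> n (y n)) \<longlonglongrightarrow> 0"
proof (rule ccontr)
  assume "\<not> (\<lambda>n. \<phi> n (y n)) \<longlonglongrightarrow> 0"
  then obtain e where e: "0 < e" and often: "\<And>N. \<exists>n\<ge>N. e \<le> \<bar>\<phi> n (y n)\<bar>"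
    unfolding lim_sequentially dist_real_def by (auto simp: not_less)
  have top: "topspace T = UNIV" by (simp add: T_def topspace_seminorm_topology)
  have lin: "linear_functional_on UNIV (\<phi> n)" for n
    using topological_dual_linear[OF \<phi>] by (simp add: top)
  have \<phi>0: "\<phi> n 0 = 0" for n using linear_functional_on_diff[OF lin subspace_UNIV, of 0 0] by simp
  have row: "(\<lambda>n. \<phi> m (y n)) \<longlonglongrightarrow> 0" for m
    using continuous_map_limit[OF topological_dual_continuous[OF \<phi>] y, of m] by (simp add: \<phi>0 o_def)
  \<comment> \<open>A single vector is a series with one nonzero term, so evaluation at
    \<open>x\<close> is among the bidual elements already treated.\<close>
  have col: "(\<lambda>n. \<phi> n x) \<longlonglongrightarrow> 0" for x
  proof -
    have supp: "finite {0::nat}" by simp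
    have "(\<Sum>j. f (if j = 0 then x else 0)) = f x" if "f 0 = 0" for f :: "'a \<Rightarrow> real"
      by (subst suminf_finite[OF supp]) (use that in auto)
    moreover have "summable (\<lambda>j. p (if j = (0::nat) then x else 0))" if "p \<in> P" for p
      by (rule summable_finite[OF supp]) (use seminorm_on_zero[OF P[OF that] UNIV_I] in auto)
    ultimately show ?thesis
      using weakly_null_functionals_on_series[OF P \<phi>[unfolded T_def] lim[unfolded T_def],
          of "\<lambda>j. if j = 0 then x else 0"] \<phi>0 by simp
  qed
  have "0 \<in> topspace T" by (simp add: top)
  then obtain U where U: "\<forall>n. openin T (U n) \<and> 0 \<in> U n" "decseq U"
    "\<forall>W. openin T W \<and> 0 \<in> W \<longrightarrow> (\<exists>n. U n \<subseteq> W)"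
    using metrizable_decreasing_base[OF met] by blast
  \<comment> \<open>The off-diagonal terms will add up to at most \<open>2 * d = e / 4\<close>,
    which leaves more than \<open>e / 2\<close> of a diagonal term of size at least
    \<open>e\<close>.\<close>
  define d where "d = e / 8"
  have d: "0 < d" using e by (simp add: d_def)
  \<comment> \<open>The factor \<open>2 ^ j\<close> forces summability: the \<open>U j\<close> form
    a base, so every seminorm satisfies \<open>p (y (k j)) \<le> (1/2) ^ j\<close> from some
    \<open>j\<close> on, however many seminorms there are.\<close>
  define good where "good j n \<longleftrightarrow> e \<le> \<bar>\<phi> n (y n)\<bar> \<and> 2 ^ j *\<^sub>R y n \<in> U j" for j n
  \<comment> \<open>Smallness is required against all \<open>i \<le> m\<close>, not only against
    chosen indices, so that each choice depends on the last index alone. The exponent is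
    \<open>Suc j\<close> because step \<open>j\<close> selects \<open>k (Suc j)\<close>.\<close>
  define sparse where "sparse j m n \<longleftrightarrow>
    m < n \<and> (\<forall>i\<le>m. \<bar>\<phi> i (y n)\<bar> \<le> d * (1/2) ^ Suc j \<and> \<bar>\<phi> n (y i)\<bar> \<le> d * (1/2) ^ Suc j)" for j m n
  have null_iff: "limitin T s 0 sequentially \<longleftrightarrow> (\<forall>p\<in>P. (\<lambda>n. p (s n)) \<longlonglongrightarrow> 0)" for s
    unfolding T_def by (rule limitin_seminorm_topology_zero) (rule P)
  have scaled: "limitin T (\<lambda>n. c *\<^sub>R y n) 0 sequentially" for c
  proof -
    have "(\<lambda>n. p (c *\<^sub>R y n)) \<longlonglongrightarrow> 0" if p: "p \<in> P" for p
    proof -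
      have "(\<lambda>n. p (y n)) \<longlonglongrightarrow> 0"
        using y p unfolding null_iff by blast
      then have "(\<lambda>n. \<bar>c\<bar> * p (y n)) \<longlonglongrightarrow> 0" by (rule tendsto_mult_right_zero)
      then show ?thesis using seminorm_on_scale[OF P[OF p] UNIV_I] by simp
    qed
    then show ?thesis unfolding null_iff by blast
  qed
  have ev: "\<forall>\<^sub>F n in sequentially. 2 ^ j *\<^sub>R y n \<in> U j" for j
    using scaled U(1) unfolding limitin_def by blast
  have pick: "\<exists>n. good j n \<and> R n" if R: "\<forall>\<^sub>F n in sequentially. R n" for j R
  proof -
    obtain N where "\<And>n. N \<le> n \<Longrightarrow> 2 ^ j *\<^sub>R y n \<in> U j \<and> R n"
      using eventually_conj[OF ev R] unfolding eventually_sequentially by blast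
    then show ?thesis using often[of N] unfolding good_def by blast
  qed
  have "\<exists>k. \<forall>j. good j (k j) \<and> sparse j (k j) (k (Suc j))"
  proof (rule dependent_nat_choice)
    show "\<exists>n. good 0 n" using pick[of "\<lambda>_. True" 0] by simp
  next
    fix m j
    have small: "\<forall>\<^sub>F n in sequentially. \<bar>s n\<bar> \<le> d * (1/2) ^ Suc j" if "s \<longlonglongrightarrow> 0" for s :: "nat \<Rightarrow> real"
    proof -
      have "\<forall>\<^sub>F n in sequentially. dist (s n) 0 < d * (1/2) ^ Suc j"
        using that by (rule tendstoD) (use d in simp)
      then show ?thesis by (rule eventually_mono) simp
    qed
    have "\<forall>\<^sub>F n in sequentially. \<forall>i\<in>{..m}. \<bar>\<phi> i (y n)\<bar> \<le> d * (1/2) ^ Suc j \<and> \<bar>\<phi> n (y i)\<bar> \<le> d * (1/2) ^ Suc j"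
      by (intro eventually_ball_finite ballI eventually_conj small row col) simp
    with eventually_gt_at_top[of m] have "\<forall>\<^sub>F n in sequentially. sparse j m n"
      unfolding sparse_def by eventually_elim auto
    then show "\<exists>n. good (Suc j) n \<and> sparse j m n" by (rule pick)
  qed
  then obtain k where k: "\<And>j. good j (k j)" "\<And>j. sparse j (k j) (k (Suc j))" by blast
  have mono: "strict_mono k"
    using k(2) by (intro strict_monoI_Suc) (simp add: sparse_def)
  define z where "z j = y (k j)" for j
  have z: "summable (\<lambda>j. p (z j))" if p: "p \<in> P" for p
  proof -
    have nonneg: "0 \<le> p x" for x using seminorm_on_nonneg[OF P[OF p] subspace_UNIV] by simp
    \<comment> \<open>Some \<open>U N\<close> lies in the unit ball of \<open>p\<close>, which
      bounds \<open>p (2 ^ j *\<^sub>R z j)\<close> by 1 for all \<open>j \<ge> N\<close>.\<close>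
    have "openin T {x \<in> UNIV. p (x - 0) < 1}"
      unfolding T_def by (rule openin_seminorm_ball[OF p]) auto
    moreover have "0 \<in> {x \<in> UNIV. p (x - 0) < 1}"
      using seminorm_on_zero[OF P[OF p] UNIV_I] by simp
    ultimately obtain N where N: "U N \<subseteq> {x \<in> UNIV. p (x - 0) < 1}" using U(3) by blast
    have "p (z j) \<le> (1/2) ^ j" if j: "N \<le> j" for j
    proof -
      have "2 ^ j *\<^sub>R z j \<in> U N"
        using k(1)[of j] decseqD[OF U(2) j] unfolding good_def z_def by blast
      then have "p (2 ^ j *\<^sub>R z j) < 1" using N by auto
      then have "2 ^ j * p (z j) < 1" using seminorm_on_scale[OF P[OF p] UNIV_I] by simp
      then show ?thesis by (simp add: power_one_over field_simps)
    qed
    then show ?thesis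
      by (intro summable_comparison_test'[OF summable_geometric[of "1/2 :: real"], of N]) (use nonneg in auto)
  qed
  \<comment> \<open>The later of the two indices was chosen to be small against the earlier one in
    both roles, with exponent the maximum of \<open>i\<close> and \<open>j\<close>. This is weakened
    to \<open>j\<close> so that the bound sums over \<open>j\<close>.\<close>
  have off: "\<bar>\<phi> (k i) (z j)\<bar> \<le> d * (1/2) ^ j" if ij: "i \<noteq> j" for i j
  proof (cases "i < j")
    case True
    then obtain j' where j: "j = Suc j'" "i \<le> j'" by (cases j) auto
    then have "k i \<le> k j'" using mono by (simp add: strict_mono_less_eq)
    then show ?thesis using k(2)[of j'] j unfolding sparse_def z_def by blast
  next
    case False
    then obtain i' where i: "i = Suc i'" "j \<le> i'" using ij by (cases i) auto
    then have "k j \<le> k i'" using mono by (simp add: strict_mono_less_eq)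
    then have "\<bar>\<phi> (k i) (z j)\<bar> \<le> d * (1/2) ^ i" using k(2)[of i'] i unfolding sparse_def z_def by blast
    also have "\<dots> \<le> d * (1/2) ^ j" using d i by (intro mult_left_mono power_decreasing) auto
    finally show ?thesis .
  qed
  have "e / 2 \<le> \<bar>\<Sum>j. \<phi> (k i) (z j)\<bar>" for i
  proof -
    define a where "a j = \<phi> (k i) (z j)" for j
    have a: "summable a"
      unfolding a_def by (intro summable_dual[of P z "\<phi> (k i)"] P z \<phi>[unfolded T_def])
    define b where "b j = (if j = i then 0 else a j)" for j
    have single: "(\<lambda>j. if j = i then a j else 0) sums a i" by (rule sums_single)
    have "(\<lambda>j. a j - (if j = i then a j else 0)) sums (suminf a - a i)"
      by (rule sums_diff[OF summable_sums[OF a] single])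
    moreover have "(\<lambda>j. a j - (if j = i then a j else 0)) = b" by (auto simp: b_def)
    ultimately have b: "b sums (suminf a - a i)" by simp
    have geo: "(\<lambda>j. d * (1/2) ^ j) sums (d * 2)"
      using geometric_sums[of "1/2 :: real"] by (intro sums_mult) simp
    have le: "\<bar>b j\<bar> \<le> d * (1/2) ^ j" for j using off[of i j] d by (auto simp: b_def a_def)
    have "\<bar>suminf b\<bar> \<le> d * 2"
      using norm_suminf_le[of b "\<lambda>j. d * (1/2) ^ j"] le geo
      by (simp add: sums_iff)
    then have "\<bar>suminf a - a i\<bar> \<le> e / 4" using b by (simp add: sums_iff d_def)
    moreover have "e \<le> \<bar>a i\<bar>" using k(1)[of i] by (simp add: good_def a_def z_def)
    ultimately show ?thesis using e unfolding a_def by linarith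
  qed
  \<comment> \<open>The series does not depend on \<open>i\<close>: it is one bidual element, tested
    along a subsequence of \<open>\<phi>\<close>.\<close>
  moreover have "(\<lambda>i. \<Sum>j. \<phi> (k i) (z j)) \<longlonglongrightarrow> 0"
    using LIMSEQ_subseq_LIMSEQ[OF weakly_null_functionals_on_series[OF P \<phi>[unfolded T_def] lim[unfolded T_def] z] mono]
    by (simp add: o_def)
  then have "\<forall>\<^sub>F i in sequentially. \<bar>\<Sum>j. \<phi> (k i) (z j)\<bar> < e / 2"
    using tendstoD[of _ 0 sequentially "e / 2"] e by fastforce
  ultimately show False
    by (metis (no_types, lifting) eventually_sequentially order_refl not_less)
qed

section \<open>Splitting positive weakly null sequences along the ideal\<close>

theorem theorem3p2:
  fixes \<tau> :: "'a::riesz_space topology" and I :: "'a set"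
  assumes "frechet_lattice \<tau>"
    and "riesz_ideal I" and "closedin \<tau> I"
    and "seq_weak_dunford_pettis (subtopology \<tau> I)"
    and "positive_schur (range (coset I)) coset_le (coset I 0)
           (quotient_topology (weak_topology \<tau>) (coset I))
           (quotient_topology \<tau> (coset I))"
  shows "seq_weak_dunford_pettis \<tau>"
  unfolding seq_weak_dunford_pettis_def
proof (intro allI impI, elim conjE)
  obtain P where P: "\<And>p. p \<in> P \<Longrightarrow> riesz_seminorm p" and \<tau>: "\<tau> = seminorm_topology UNIV P"
    using assms(1) unfolding frechet_lattice_def locally_convex_solid_def by blast
  have met: "metrizable_space \<tau>" using assms(1) by (simp add: frechet_lattice_def)
  have P': "seminorm_on UNIV p" if "p \<in> P" for p using riesz_seminorm_seminorm_on P that by blast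
  have top: "topspace \<tau> = UNIV" by (simp add: \<tau> topspace_seminorm_topology)
  have sub: "subspace I" and solid: "\<And>x y. y \<in> I \<Longrightarrow> \<bar>x\<bar> \<le> \<bar>y\<bar> \<Longrightarrow> x \<in> I"
    using assms(2) unfolding riesz_ideal_def by blast+
  fix x \<phi>
  assume x: "\<forall>n::nat. x n \<in> topspace \<tau> \<and> 0 \<le> x n" "limitin (weak_topology \<tau>) x 0 sequentially"
    and \<phi>: "\<forall>n. \<phi> n \<in> topological_dual \<tau>"
      "limitin (weak_topology (strong_dual \<tau>)) \<phi> 0 sequentially"
  have "limitin (quotient_topology (weak_topology \<tau>) (coset I)) (\<lambda>n. coset I (x n)) (coset I 0) sequentially"
    using continuous_map_limit[OF quotient_imp_continuous_map[OF quotient_map_quotient_topology] x(2)]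
    by (simp only: o_def)
  moreover have "coset I (x n) \<in> range (coset I) \<and> coset_le (coset I 0) (coset I (x n))" for n
  proof -
    have "0 \<in> coset I 0" "x n \<in> coset I (x n)" using subspace_0[OF sub] by (auto simp: coset_def)
    then show ?thesis using x(1) unfolding coset_le_def by blast
  qed
  ultimately have "limitin (quotient_topology \<tau> (coset I)) (\<lambda>n. coset I (x n)) (coset I 0) sequentially"
    by (intro assms(5)[unfolded positive_schur_def, THEN spec, THEN mp] conjI allI) blast+
  then obtain u where u: "\<And>n. x n - u n \<in> I" "limitin \<tau> u 0 sequentially"
    using quotient_null_lift[OF met[unfolded \<tau>] sub] unfolding \<tau> by blast
  define v where "v n = inf (x n) \<bar>x n - u n\<bar>" for n
  have v: "0 \<le> v n" "v n \<le> x n" for n using x(1) by (auto simp: v_def)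
  have vI: "v n \<in> I" for n
    by (rule solid[OF u(1)[of n]]) (use v(1)[of n] in \<open>simp add: abs_of_nonneg, simp add: v_def\<close>)
  have diff: "\<bar>x n - v n\<bar> \<le> \<bar>u n\<bar>" for n
  proof -
    \<comment> \<open>Subtracting the infimum leaves the positive part of
      \<open>x n - \<bar>x n - u n\<bar>\<close>, which the triangle inequality bounds by
      \<open>\<bar>u n\<bar>\<close>.\<close>
    have "x n - v n = sup 0 (x n - \<bar>x n - u n\<bar>)"
      unfolding v_def by (simp add: diff_inf_eq_sup add_sup_distrib_left)
    also have "\<dots> \<le> \<bar>u n\<bar>"
    proof (rule sup_least)
      have "x n = (x n - u n) + u n" by simp
      also have "\<dots> \<le> \<bar>x n - u n\<bar> + \<bar>u n\<bar>" by (intro add_mono abs_ge_self)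
      finally show "x n - \<bar>x n - u n\<bar> \<le> \<bar>u n\<bar>" by (simp add: algebra_simps)
    qed simp
    finally show ?thesis using v(2)[of n] by (simp add: abs_of_nonneg)
  qed
  have null_iff: "limitin \<tau> s 0 sequentially \<longleftrightarrow> (\<forall>p\<in>P. (\<lambda>n. p (s n)) \<longlonglongrightarrow> 0)" for s
    unfolding \<tau> by (rule limitin_seminorm_topology_zero) (rule P')
  have "(\<lambda>n. p (x n - v n)) \<longlonglongrightarrow> 0" if p: "p \<in> P" for p
  proof (rule tendsto_sandwich[OF _ _ tendsto_const])
    show "(\<lambda>n. p (u n)) \<longlonglongrightarrow> 0"
      using u(2) p unfolding null_iff by blast
    show "\<forall>\<^sub>F n in sequentially. 0 \<le> p (x n - v n)"
      using seminorm_on_nonneg[OF P'[OF p] subspace_UNIV] by simp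
    show "\<forall>\<^sub>F n in sequentially. p (x n - v n) \<le> p (u n)"
      using riesz_seminorm_mono[OF P[OF p] diff] by simp
  qed
  then have "limitin \<tau> (\<lambda>n. x n - v n) 0 sequentially"
    unfolding null_iff by blast
  then have "(\<lambda>n. \<phi> n (x n - v n)) \<longlonglongrightarrow> 0"
    using weakly_null_functionals_on_null_sequence[OF P' met[unfolded \<tau>]] \<phi> unfolding \<tau> by blast
  moreover have "(\<lambda>n. \<phi> n (v n)) \<longlonglongrightarrow> 0"
  proof -
    have "limitin (weak_topology (subtopology \<tau> I)) v 0 sequentially"
      using weakly_null_dominated_in_ideal[OF assms(2) P x(2)[unfolded \<tau>] vI v] unfolding \<tau> by blast
    moreover have "I \<subseteq> topspace \<tau>" by (simp add: top)
    note weakly_null_restrict[OF sub this spec[OF \<phi>(1)] \<phi>(2)]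
    \<comment> \<open>The restriction of \<open>\<phi> n\<close> to \<open>I\<close> appears as its
      extension by 0, the form of the elements of
      \<open>topological_dual (subtopology \<tau> I)\<close>.\<close>
    ultimately have "(\<lambda>n. if v n \<in> I then \<phi> n (v n) else 0) \<longlonglongrightarrow> 0"
      using assms(4)[unfolded seq_weak_dunford_pettis_def, rule_format, of v "\<lambda>n x. if x \<in> I then \<phi> n x else 0"]
        vI v(1) by (simp add: top)
    then show ?thesis using vI by simp
  qed
  ultimately have "(\<lambda>n. \<phi> n (x n - v n) + \<phi> n (v n)) \<longlonglongrightarrow> 0" using tendsto_add by fastforce
  moreover have "\<phi> n (x n - v n) + \<phi> n (v n) = \<phi> n (x n)" for n
    using linear_functional_on_diff[OF topological_dual_linear[OF spec[OF \<phi>(1)]], of "x n" "v n" n] by (simp add: top)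
  ultimately show "(\<lambda>n. \<phi> n (x n)) \<longlonglongrightarrow> 0" by simp
qed

end
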